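(* Consider the genie-aided four-block estimation problem described in the context, with unknown parameters $x^\star=X^\star_{i,\cdot}$ and $y^\star=Y^\star_{t,\cdot}$ and target $(M_d^\star)_{i,t}=\langle x^\star,y^\star\rangle$, where $N_1<i\le N$ and $T_1<t\le T$, and where $U_1^{\star\top}U_1^\star$ and $V_1^{\star\top}V_1^\star$ are invertible. The Cramér–Rao lower bound for estimating $(M_d^\star)_{i,t}$ is $$\gamma^\star_{i,t}=\frac{\omega^2}{NT}\Big\{U^\star_{i,\cdot}(U_1^{\star\top}U_1^\star)^{-1}U_{i,\cdot}^{\star\top}+V^\star_{t,\cdot}(V_1^{\star\top}V_1^\star)^{-1}V_{t,\cdot}^{\star\top}\Big\}.$$ More generally, if there are constants $0<c_\ell\le c_u<\infty$ with $$c_\ell\tfrac{N_1}{N} I_r\preceq U_1^{\star\top}U_1^\star\preceq c_u\tfrac{N_1}{N} I_r,\qquad c_\ell\tfrac{T_1}{T} I_r\preceq V_1^{\star\top}V_1^\star\preceq c_u\tfrac{T_1}{T} I_r,$$ then the local minimax risk at scale $\varepsilon_{N,T}=\frac{\sqrt{\sigma_r^\star}}{\sqrt{\min\{N,T\}}}$ satisfies $$R_{\mathrm{loc}}(\varepsilon_{N,T})\ \ge\ \Big(1-\frac{c_u\pi^2}{c_\ell^2}\,\rho_{N,T}^2\Big)\gamma^\star_{i,t},\qquad \rho_{N,T}=\frac{\omega}{\sigma_r^\star}\frac{1}{\sqrt{\min\{N_1,T_1\}}}.$$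
   Context: $N=N_1+N_2$, $T=T_1+T_2$ are positive integers. $M^\star\in\mathbb R^{N\times T}$ has rank $r$ and compact SVD $M^\star=U^\star\Sigma^\star V^{\star\top}$ with $\Sigma^\star=\mathrm{diag}(\sigma_1^\star,\dots,\sigma_r^\star)$, $\sigma_1^\star\ge\dots\ge\sigma_r^\star>0$, and $U^\star\in\mathbb R^{N\times r},V^\star\in\mathbb R^{T\times r}$ with orthonormal columns; $U_1^\star$ (resp. $V_1^\star$) is the first $N_1$ rows of $U^\star$ (resp. first $T_1$ rows of $V^\star$). $M_d^\star$ is the bottom-right $N_2\times T_2$ block of $M^\star$, indexed by positions $(i,t)$ of the full matrix. Set $X^\star=U^\star(\Sigma^\star)^{1/2}$, $Y^\star=V^\star(\Sigma^\star)^{1/2}$, so $M^\star=X^\star Y^{\star\top}$. Genie-aided problem for $(i,t)$: all rows of $X^\star$ except the $i$-th and all rows of $Y^\star$ except the $t$-th are known. The only unknowns are $x^\star=X^\star_{i,\cdot}\in\mathbb R^r$ and $y^\star=Y^\star_{t,\cdot}\in\mathbb R^r$. One observes the $N_1+T_1$ measurements $$M_{i,s}=\langle x^\star,Y^\star_{s,\cdot}\rangle+E_{i,s}\ (1\le s\le T_1),\qquad M_{k,t}=\langle X^\star_{k,\cdot},y^\star\rangle+E_{k,t}\ (1\le k\le N_1),$$ with all noise variables i.i.d. $\mathcal N(0,\omega^2/(NT))$. The Cramér–Rao lower bound for estimating $\Psi(\theta)=\langle x^\star,y^\star\rangle$, $\theta=(x^\star,y^\star)$, is $\nabla\Psi(\theta)^\top\mathcal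 I(\theta)^{-1}\nabla\Psi(\theta)$, where $\mathcal I(\theta)$ is the Fisher information matrix of the observations. The local minimax risk at scale $\varepsilon>0$ is $$R_{\mathrm{loc}}(\varepsilon)=\inf_{\widehat M_{i,t}}\ \sup_{x\in\mathcal B_\infty(x^\star,\varepsilon),\ y\in\mathcal B_\infty(y^\star,\varepsilon)}\mathbb E\big[(\widehat M_{i,t}-\langle x,y\rangle)^2\big],$$ where $\mathcal B_\infty(z,\varepsilon)$ is the $\ell_\infty$-ball of radius $\varepsilon$ around $z$ in $\mathbb R^r$, the infimum is over all (measurable) estimators based on the measurements above, and the expectation is under the same measurement model with true parameters $(x,y)$ in place of $(x^\star,y^\star)$. *)

theory Defs
  imports "HOL-Probability.Probability"
begin

section \<open>Matrices\<close>

definition diag_mat :: "real^'n \<Rightarrow> real^'n^'n" where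
  "diag_mat d = (\<chi> a b. if a = b then d $ a else 0)"

definition loewner_le :: "real^'n^'n \<Rightarrow> real^'n^'n \<Rightarrow> bool"  (infix \<open>\<preceq>\<^sub>L\<close> 50) where
  "A \<preceq>\<^sub>L B \<longleftrightarrow> transpose (B - A) = B - A \<and> (\<forall>v. 0 \<le> v \<bullet> ((B - A) *v v))"

text \<open>The rows of a matrix with \<open>N\<^sub>1 + N\<^sub>2\<close> rows are indexed by a sum type, so that
  \<open>Inl\<close> injects the indices of the first \<open>N\<^sub>1\<close> rows and \<open>Inr\<close> those of the remaining \<open>N\<^sub>2\<close>.\<close>

definition upper_rows :: "real^'r^('n1::finite + 'n2::finite) \<Rightarrow> real^'r^'n1" where
  "upper_rows A = (\<chi> k. A $ Inl k)"

text \<open>The order on the index type \<open>'r\<close> only serves to list the singular values in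
  nonincreasing order; the smallest one is the entry at \<open>Max UNIV\<close>.\<close>

definition compact_svd ::
  "real^'m^'n \<Rightarrow> real^('r::{finite,linorder})^'n \<Rightarrow> real^('r::_) \<Rightarrow> real^('r::_)^'m \<Rightarrow> bool" where
  "compact_svd M U \<sigma> V \<longleftrightarrow>
     M = U ** diag_mat \<sigma> ** transpose V \<and>
     transpose U ** U = mat 1 \<and> transpose V ** V = mat 1 \<and>
     (\<forall>a. 0 < \<sigma> $ a) \<and> (\<forall>a b. a \<le> b \<longrightarrow> \<sigma> $ b \<le> \<sigma> $ a)"

definition smallest_sv :: "real^('r::{finite,linorder}) \<Rightarrow> real" where
  "smallest_sv \<sigma> = \<sigma> $ Max UNIV"

definition scaled_factor :: "real^'r^'n \<Rightarrow> real^'r \<Rightarrow> real^'r^'n" where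
  "scaled_factor U \<sigma> = U ** diag_mat (\<chi> a. sqrt (\<sigma> $ a))"

section \<open>Fisher information and the Cramer--Rao bound\<close>

definition gradient :: "('a::real_inner \<Rightarrow> real) \<Rightarrow> 'a \<Rightarrow> 'a" where
  "gradient f \<theta> = (THE D. GDERIV f \<theta> :> D)"

text \<open>Here \<open>p \<theta>\<close> is the density with respect to \<open>\<mu>\<close> of the law of the observations under the
  parameter \<open>\<theta>\<close>.\<close>

definition fisher_information ::
  "'z measure \<Rightarrow> (real^'p \<Rightarrow> 'z \<Rightarrow> real) \<Rightarrow> real^'p \<Rightarrow> real^'p^'p" where
  "fisher_information \<mu> p \<theta> =
     (\<chi> a b. \<integral>z. gradient (\<lambda>\<theta>'. ln (p \<theta>' z)) \<theta> $ a * gradient (\<lambda>\<theta>'. ln (p \<theta>' z)) \<theta> $ b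
              \<partial>density \<mu> (\<lambda>z. ennreal (p \<theta> z)))"

definition cramer_rao_bound ::
  "'z measure \<Rightarrow> (real^'p \<Rightarrow> 'z \<Rightarrow> real) \<Rightarrow> (real^'p \<Rightarrow> real) \<Rightarrow> real^'p \<Rightarrow> real" where
  "cramer_rao_bound \<mu> p \<Psi> \<theta> =
     gradient \<Psi> \<theta> \<bullet> (matrix_inv (fisher_information \<mu> p \<theta>) *v gradient \<Psi> \<theta>)"

section \<open>The genie-aided model\<close>

text \<open>The parameter \<open>\<theta> = (x, y)\<close> is a vector indexed by \<open>'r + 'r\<close>.\<close>

definition join_param :: "real^'r \<Rightarrow> real^'r \<Rightarrow> real^('r::finite + 'r)" where
  "join_param x y = (\<chi> j. case j of Inl a \<Rightarrow> x $ a | Inr a \<Rightarrow> y $ a)"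

definition x_part :: "real^('r::finite + 'r) \<Rightarrow> real^'r" where
  "x_part \<theta> = (\<chi> a. \<theta> $ Inl a)"

definition y_part :: "real^('r::finite + 'r) \<Rightarrow> real^'r" where
  "y_part \<theta> = (\<chi> a. \<theta> $ Inr a)"

definition target :: "real^('r::finite + 'r) \<Rightarrow> real" where
  "target \<theta> = x_part \<theta> \<bullet> y_part \<theta>"

text \<open>Observations are indexed by \<open>'t1 + 'n1\<close>: \<open>Inl s\<close> stands for the entry \<open>(i, s)\<close> in the row of
  interest and \<open>Inr k\<close> for the entry \<open>(k, t)\<close> in the column of interest. Only the known rows
  with indices of the form \<open>Inl\<close> enter.\<close>

definition signal ::
  "real^'r^('n1::finite + 'n2::finite) \<Rightarrow> real^'r^('t1::finite + 't2::finite) \<Rightarrow>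
   real^('r + 'r) \<Rightarrow> 't1 + 'n1 \<Rightarrow> real" where
  "signal X Y \<theta> j =
     (case j of Inl s \<Rightarrow> x_part \<theta> \<bullet> Y $ Inl s | Inr k \<Rightarrow> X $ Inl k \<bullet> y_part \<theta>)"

definition gaussian_noise :: "real \<Rightarrow> ('j::finite \<Rightarrow> real) measure" where
  "gaussian_noise \<tau> = (\<Pi>\<^sub>M j\<in>UNIV. density lborel (\<lambda>e. ennreal (normal_density 0 \<tau> e)))"

definition observation_law ::
  "real \<Rightarrow> real^'r^('n1::finite + 'n2::finite) \<Rightarrow> real^'r^('t1::finite + 't2::finite) \<Rightarrow>
   real^('r + 'r) \<Rightarrow> ('t1 + 'n1 \<Rightarrow> real) measure" where
  "observation_law \<tau> X Y \<theta> =
     distr (gaussian_noise \<tau>) (\<Pi>\<^sub>M j\<in>UNIV. borel) (\<lambda>e j. signal X Y \<theta> j + e j)"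

definition likelihood ::
  "real \<Rightarrow> real^'r^('n1::finite + 'n2::finite) \<Rightarrow> real^'r^('t1::finite + 't2::finite) \<Rightarrow>
   real^('r + 'r) \<Rightarrow> ('t1 + 'n1 \<Rightarrow> real) \<Rightarrow> real" where
  "likelihood \<tau> X Y \<theta> z = (\<Prod>j\<in>UNIV. normal_density (signal X Y \<theta> j) \<tau> (z j))"

lemma observation_law_eq_density:
  assumes "0 < \<tau>"
  shows "observation_law \<tau> X Y \<theta> =
    density (\<Pi>\<^sub>M j\<in>UNIV. lborel) (\<lambda>z. ennreal (likelihood \<tau> X Y \<theta> z))"
proof -
  let ?m = "signal X Y \<theta>"
  define P where "P m = density lborel (\<lambda>e. ennreal (normal_density m \<tau> e))" for m
  have prob: "prob_space (P m)" for m
    unfolding P_def by (rule prob_space_normal_density[OF assms])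
  have sets_P [measurable_cong]: "sets (P m) = sets borel" for m
    by (simp add: P_def)
  interpret P0: product_prob_space "\<lambda>_. P 0" UNIV
    by (intro product_prob_spaceI prob)
  interpret Pm: product_prob_space "\<lambda>j. P (?m j)" UNIV
    by (intro product_prob_spaceI prob)
  interpret L: product_sigma_finite "\<lambda>_. lborel :: real measure"
    by standard
  have noise: "gaussian_noise \<tau> = Pi\<^sub>M UNIV (\<lambda>_. P 0)"
    by (simp add: gaussian_noise_def P_def)
  have shift: "emeasure (P 0) ((\<lambda>e. m + e) -` A) = emeasure (P m) A"
    if [measurable]: "A \<in> sets borel" for m A
  proof -
    have [measurable]: "(\<lambda>e. m + e) -` A \<in> sets borel"
      using measurable_sets[of "\<lambda>e. m + e" borel borel A] by simp
    have "emeasure (P m) A = (\<integral>\<^sup>+e. ennreal (normal_density m \<tau> e) * indicator A e \<partial>lborel)"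
      by (simp add: P_def emeasure_density)
    also have "\<dots> = (\<integral>\<^sup>+e. ennreal (normal_density m \<tau> (m + e)) * indicator A (m + e) \<partial>lborel)"
      by (subst nn_integral_real_affine[where c = 1 and t = m]) auto
    also have "\<dots> = (\<integral>\<^sup>+e. ennreal (normal_density 0 \<tau> e) * indicator ((\<lambda>e. m + e) -` A) e \<partial>lborel)"
      by (intro nn_integral_cong) (simp add: normal_density_def indicator_def)
    also have "\<dots> = emeasure (P 0) ((\<lambda>e. m + e) -` A)"
      by (simp add: P_def emeasure_density)
    finally show ?thesis ..
  qed
  have "observation_law \<tau> X Y \<theta> = Pi\<^sub>M UNIV (\<lambda>j. P (?m j))"
    unfolding observation_law_def noise
  proof (rule Pm.PiM_eqI)
    show "sets (distr (Pi\<^sub>M UNIV (\<lambda>_. P 0)) (Pi\<^sub>M UNIV (\<lambda>_. borel)) (\<lambda>e j. ?m j + e j)) =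
      sets (Pi\<^sub>M UNIV (\<lambda>j. P (?m j)))"
      by (simp add: sets_P cong: sets_PiM_cong)
  next
    fix A assume A: "\<And>j. j \<in> UNIV \<Longrightarrow> A j \<in> sets (P (?m j))"
    have [measurable]: "(\<lambda>e j. ?m j + e j) \<in> Pi\<^sub>M UNIV (\<lambda>_. P 0) \<rightarrow>\<^sub>M Pi\<^sub>M UNIV (\<lambda>_. borel)"
      by (rule measurable_PiM_single') (auto simp: space_PiM PiE_def)
    have PA: "Pi UNIV A \<in> sets (Pi\<^sub>M UNIV (\<lambda>_. borel))"
      using sets_PiM_I_finite[of UNIV A "\<lambda>_. borel"] A by (simp add: sets_P PiE_def)
    have pre: "(\<lambda>e. ?m j + e) -` A j \<in> sets (P 0)" for j
      using measurable_sets[of "\<lambda>e. ?m j + e" borel borel "A j"] A[of j] by (simp add: sets_P)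
    have "emeasure (distr (Pi\<^sub>M UNIV (\<lambda>_. P 0)) (Pi\<^sub>M UNIV (\<lambda>_. borel)) (\<lambda>e j. ?m j + e j)) (Pi\<^sub>E UNIV A)
      = emeasure (Pi\<^sub>M UNIV (\<lambda>_. P 0)) (Pi\<^sub>E UNIV (\<lambda>j. (\<lambda>e. ?m j + e) -` A j))"
      by (subst emeasure_distr)
         (auto simp: PA space_PiM PiE_def P_def intro!: arg_cong[where f = "emeasure _"])
    also have "\<dots> = (\<Prod>j\<in>UNIV. emeasure (P 0) ((\<lambda>e. ?m j + e) -` A j))"
      by (rule P0.emeasure_PiM) (auto simp: pre)
    also have "\<dots> = (\<Prod>j\<in>UNIV. emeasure (P (?m j)) (A j))"
      using A by (intro prod.cong shift) (auto simp: sets_P)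
    finally show "emeasure (distr (Pi\<^sub>M UNIV (\<lambda>_. P 0)) (Pi\<^sub>M UNIV (\<lambda>_. borel)) (\<lambda>e j. ?m j + e j)) (Pi\<^sub>E UNIV A)
      = (\<Prod>j\<in>UNIV. emeasure (P (?m j)) (A j))" .
  qed simp
  also have "\<dots> = density (Pi\<^sub>M UNIV (\<lambda>_. lborel)) (\<lambda>z. ennreal (likelihood \<tau> X Y \<theta> z))"
  proof (rule sym, rule Pm.PiM_eqI)
    show "sets (density (Pi\<^sub>M UNIV (\<lambda>_. lborel)) (\<lambda>z. ennreal (likelihood \<tau> X Y \<theta> z))) =
      sets (Pi\<^sub>M UNIV (\<lambda>j. P (?m j)))"
      by (simp add: P_def cong: sets_PiM_cong)
  next
    fix A assume A: "\<And>j. j \<in> UNIV \<Longrightarrow> A j \<in> sets (P (?m j))"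
    then have [measurable]: "A j \<in> sets borel" for j by (simp add: sets_P)
    have "emeasure (density (Pi\<^sub>M UNIV (\<lambda>_. lborel)) (\<lambda>z. ennreal (likelihood \<tau> X Y \<theta> z))) (Pi\<^sub>E UNIV A)
      = (\<integral>\<^sup>+z. ennreal (likelihood \<tau> X Y \<theta> z) * indicator (Pi\<^sub>E UNIV A) z \<partial>Pi\<^sub>M UNIV (\<lambda>_. lborel))"
      by (intro emeasure_density) (auto simp: likelihood_def intro!: sets_PiM_I_finite)
    also have "\<dots> = (\<integral>\<^sup>+z. (\<Prod>j\<in>UNIV. ennreal (normal_density (?m j) \<tau> (z j)) * indicator (A j) (z j))
        \<partial>Pi\<^sub>M UNIV (\<lambda>_. lborel))"
    proof (intro nn_integral_cong)
      fix z
      have "indicator (Pi\<^sub>E UNIV A) z = (\<Prod>j\<in>UNIV. indicator (A j) (z j) :: ennreal)"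
        by (cases "\<forall>j. z j \<in> A j") (auto simp: indicator_def PiE_def Pi_def)
      then show "ennreal (likelihood \<tau> X Y \<theta> z) * indicator (Pi\<^sub>E UNIV A) z =
          (\<Prod>j\<in>UNIV. ennreal (normal_density (?m j) \<tau> (z j)) * indicator (A j) (z j))"
        by (simp add: likelihood_def prod_ennreal prod.distrib)
    qed
    also have "\<dots> = (\<Prod>j\<in>UNIV. \<integral>\<^sup>+e. ennreal (normal_density (?m j) \<tau> e) * indicator (A j) e \<partial>lborel)"
      by (rule L.product_nn_integral_prod) auto
    also have "\<dots> = (\<Prod>j\<in>UNIV. emeasure (P (?m j)) (A j))"
      by (simp add: P_def emeasure_density)
    finally show "emeasure (density (Pi\<^sub>M UNIV (\<lambda>_. lborel)) (\<lambda>z. ennreal (likelihood \<tau> X Y \<theta> z))) (Pi\<^sub>E UNIV A)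
      = (\<Prod>j\<in>UNIV. emeasure (P (?m j)) (A j))" .
  qed simp
  finally show ?thesis .
qed

definition linf_cball :: "real^'r \<Rightarrow> real \<Rightarrow> (real^'r) set" where
  "linf_cball z \<epsilon> = {x. \<forall>a. \<bar>x $ a - z $ a\<bar> \<le> \<epsilon>}"

text \<open>The risk takes values in the extended nonnegative reals, as the mean squared error of
  an estimator may be infinite.\<close>

definition local_minimax_risk ::
  "real \<Rightarrow> real^'r^('n1::finite + 'n2::finite) \<Rightarrow> real^'r^('t1::finite + 't2::finite) \<Rightarrow>
   real^'r \<Rightarrow> real^'r \<Rightarrow> real \<Rightarrow> ennreal" where
  "local_minimax_risk \<tau> X Y x\<^sub>0 y\<^sub>0 \<epsilon> =
     (INF est \<in> borel_measurable (\<Pi>\<^sub>M j\<in>UNIV. borel).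
        SUP (x, y) \<in> linf_cball x\<^sub>0 \<epsilon> \<times> linf_cball y\<^sub>0 \<epsilon>.
          \<integral>\<^sup>+z. ennreal ((est z - x \<bullet> y)\<^sup>2) \<partial>observation_law \<tau> X Y (join_param x y))"

definition gamma_star ::
  "real \<Rightarrow> real^'r^('n1::finite + 'n2::finite) \<Rightarrow> real^'r^('t1::finite + 't2::finite) \<Rightarrow>
   'n1 + 'n2 \<Rightarrow> 't1 + 't2 \<Rightarrow> real" where
  "gamma_star \<omega> U V i t =
     \<omega>\<^sup>2 / (real CARD('n1 + 'n2) * real CARD('t1 + 't2)) *
       (U $ i \<bullet> (matrix_inv (transpose (upper_rows U) ** upper_rows U) *v (U $ i)) +
        V $ t \<bullet> (matrix_inv (transpose (upper_rows V) ** upper_rows V) *v (V $ t)))"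

end

theory Submission
  imports Defs
begin

text \<open>The measurements form a linear Gaussian model, so the Fisher information is the Gram matrix of
  the known rows divided by the noise variance. The measured row involves only \<open>x\<close> and the measured
  column only \<open>y\<close>, so this matrix is block diagonal, and each block is a Gram matrix of \<open>U\<close> or \<open>V\<close>
  scaled by the roots of the singular values on both sides. The gradient of \<open>\<langle>x, y\<rangle>\<close> is \<open>(y, x)\<close>, whose
  halves carry the same scaling; the scalings cancel and the bound \<open>\<gamma>\<close> results
  (\<open>fisher_information_solve\<close>).

  For the minimax bound, restrict the parameter to the segment
  \<open>{\<theta> + s h | s. \<bar>s\<bar> \<le> \<delta>}\<close> in the least favourable direction
  \<open>h\<close>, the inverse information matrix applied to the gradient. Along it both the slope of the target
  at the centre and the information equal \<open>\<gamma>\<close>. A Bayesian argument of van Trees type with a squared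
  cosine prior on the segment bounds the risk of every estimator below by
  \<open>2 \<gamma> - \<gamma> - \<pi>\<^sup>2 / \<delta>\<^sup>2\<close> (\<open>van_trees_line\<close>, \<open>local_minimax_risk_line\<close>).

  It remains to see how long the segment may be. The lower Loewner bounds on the Gram matrices and the
  smallest singular value control both halves of \<open>h\<close> in Euclidean norm
  (\<open>least_favourable_norm_le\<close>), hence in the supremum norm, and the choice of \<open>\<delta>\<close> that turns
  \<open>\<pi>\<^sup>2 / \<delta>\<^sup>2\<close> into the stated loss keeps the segment in the product of the two balls
  (\<open>radius_arith\<close>).\<close>

section \<open>The linear Gaussian model\<close>

lemma sum_UNIV_Plus:
  fixes f :: "'a::finite + 'b::finite \<Rightarrow> 'c::comm_monoid_add"
  shows "(\<Sum>j\<in>UNIV. f j) = (\<Sum>a\<in>UNIV. f (Inl a)) + (\<Sum>b\<in>UNIV. f (Inr b))"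
  using sum.Plus[of "UNIV :: 'a set" "UNIV :: 'b set" f] by simp

lemma inner_join_param: "join_param x y \<bullet> join_param u w = x \<bullet> u + y \<bullet> w"
  by (simp add: inner_vec_def join_param_def sum_UNIV_Plus)

lemma x_part_join_param [simp]: "x_part (join_param x y) = x"
  and y_part_join_param [simp]: "y_part (join_param x y) = y"
  by (simp_all add: x_part_def y_part_def join_param_def vec_eq_iff)

lemma join_param_parts [simp]: "join_param (x_part \<theta>) (y_part \<theta>) = \<theta>"
  by (auto simp: x_part_def y_part_def join_param_def vec_eq_iff split: sum.split)

lemma join_param_add_scaleR:
  "join_param x y + s *\<^sub>R join_param u w = join_param (x + s *\<^sub>R u) (y + s *\<^sub>R w)"
  by (auto simp: join_param_def vec_eq_iff split: sum.split)

text \<open>Each mean is linear in \<open>\<theta>\<close>, and these are the representing vectors: a row of \<open>Y\<close> acts on the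
  \<open>x\<close>-half of the parameter only and a row of \<open>X\<close> on the \<open>y\<close>-half only, which makes the
  information matrix block diagonal.\<close>

definition design_row ::
  "real^'r^('n1::finite + 'n2::finite) \<Rightarrow> real^'r^('t1::finite + 't2::finite) \<Rightarrow>
   't1 + 'n1 \<Rightarrow> real^('r + 'r)" where
  "design_row X Y j =
     (case j of Inl s \<Rightarrow> join_param (Y $ Inl s) 0 | Inr k \<Rightarrow> join_param 0 (X $ Inl k))"

lemma signal_eq_inner: "signal X Y \<theta> j = design_row X Y j \<bullet> \<theta>"
proof -
  have "signal X Y \<theta> j = design_row X Y j \<bullet> join_param (x_part \<theta>) (y_part \<theta>)"
    unfolding signal_def design_row_def
    by (cases j) (simp_all only: sum.case inner_join_param, simp_all add: inner_commute)
  then show ?thesis by simp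
qed

lemma signal_add_scaleR: "signal X Y (\<theta> + s *\<^sub>R h) j = signal X Y \<theta> j + s * signal X Y h j"
  by (simp add: signal_eq_inner inner_add_right)

lemma likelihood_eq_exp:
  fixes X :: "real^'r^('n1::finite + 'n2::finite)" and Y :: "real^'r^('t1::finite + 't2::finite)"
  shows "likelihood \<tau> X Y \<theta> z =
    (1 / sqrt (2 * pi * \<tau>\<^sup>2)) ^ CARD('t1 + 'n1) *
    exp (- (\<Sum>j\<in>UNIV. (z j - signal X Y \<theta> j)\<^sup>2) / (2 * \<tau>\<^sup>2))"
proof -
  have "(\<Prod>j\<in>UNIV. exp (- (z j - signal X Y \<theta> j)\<^sup>2 / (2 * \<tau>\<^sup>2))) =
      exp (\<Sum>j\<in>UNIV. - (z j - signal X Y \<theta> j)\<^sup>2 / (2 * \<tau>\<^sup>2))"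
    by (simp add: exp_sum)
  also have "(\<Sum>j\<in>UNIV. - (z j - signal X Y \<theta> j)\<^sup>2 / (2 * \<tau>\<^sup>2)) =
      - (\<Sum>j\<in>UNIV. (z j - signal X Y \<theta> j)\<^sup>2) / (2 * \<tau>\<^sup>2)"
    by (simp only: sum_negf sum_divide_distrib[symmetric])
  finally show ?thesis
    by (simp add: likelihood_def normal_density_def prod_dividef prod.distrib prod_constant power_one_over)
qed

lemma likelihood_pos: "0 < \<tau> \<Longrightarrow> 0 < likelihood \<tau> X Y \<theta> z"
  by (simp add: likelihood_def prod_pos normal_density_pos)

lemma prob_space_observation_law:
  fixes X :: "real^'r^('n1::finite + 'n2::finite)" and Y :: "real^'r^('t1::finite + 't2::finite)"
  assumes "0 < \<tau>"
  shows "prob_space (observation_law \<tau> X Y \<theta>)"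
proof -
  interpret P: product_prob_space
    "\<lambda>_::'t1 + 'n1. density lborel (\<lambda>e. ennreal (normal_density 0 \<tau> e))" UNIV
    by (intro product_prob_spaceI prob_space_normal_density assms)
  have "(\<lambda>e j. signal X Y \<theta> j + e j) \<in> gaussian_noise \<tau> \<rightarrow>\<^sub>M Pi\<^sub>M UNIV (\<lambda>_. borel)"
    unfolding gaussian_noise_def by (rule measurable_PiM_single') (auto simp: space_PiM PiE_def)
  then show ?thesis
    unfolding observation_law_def gaussian_noise_def by (rule P.P.prob_space_distr)
qed

text \<open>All moments needed below are of degree at most two in the noise. Covering them by monomials
  over the whole index set lets one product formula yield both the means and the covariances.\<close>

lemma gaussian_noise_monomial:
  fixes n :: "'j::finite \<Rightarrow> nat"
  assumes "0 < \<tau>"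
  shows "has_bochner_integral (gaussian_noise \<tau>) (\<lambda>e. \<Prod>j\<in>UNIV. e j ^ n j)
    (\<Prod>j\<in>UNIV. \<integral>x. normal_density 0 \<tau> x * x ^ n j \<partial>lborel)"
proof -
  let ?P = "\<lambda>_::'j. density lborel (\<lambda>e. ennreal (normal_density 0 \<tau> e))"
  interpret P: product_prob_space ?P UNIV
    by (intro product_prob_spaceI prob_space_normal_density assms)
  have int: "integrable (?P j) (\<lambda>x. x ^ n j)" for j
    using integrable_normal_moment[OF assms, of 0 "n j"] by (simp add: integrable_density)
  have "(\<integral>x. x ^ n j \<partial>?P j) = (\<integral>x. normal_density 0 \<tau> x * x ^ n j \<partial>lborel)" for j
    by (simp add: integral_density)
  then show ?thesis
    using P.product_integral_prod[of UNIV "\<lambda>j x. x ^ n j"]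
      P.product_integrable_prod[of UNIV "\<lambda>j x. x ^ n j"] int
    by (simp add: gaussian_noise_def has_bochner_integral_iff)
qed

lemma gaussian_noise_mean:
  assumes "0 < \<tau>"
  shows "has_bochner_integral (gaussian_noise \<tau>) (\<lambda>e. e (j::'j::finite)) 0"
proof -
  have "(\<Prod>l\<in>UNIV. e l ^ of_bool (l = j)) = e j" for e :: "'j \<Rightarrow> real"
    by (simp add: prod.delta of_bool_def if_distrib[of "\<lambda>n. _ ^ n"] cong: if_cong)
  moreover have "(\<Prod>l\<in>UNIV. \<integral>x. normal_density 0 \<tau> x * x ^ of_bool (l = j) \<partial>lborel) = 0"
    by (rule prod_zero) (use integral_normal_moment_odd[OF assms, of 0 0] in auto)
  ultimately show ?thesis
    using gaussian_noise_monomial[OF assms, of "\<lambda>l. of_bool (l = j)"] by (simp only:)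
qed

lemma gaussian_noise_covariance:
  assumes "0 < \<tau>"
  shows "has_bochner_integral (gaussian_noise \<tau>) (\<lambda>e. e (j::'j::finite) * e k)
    (if j = k then \<tau>\<^sup>2 else 0)"
proof -
  let ?n = "\<lambda>l. of_bool (l = j) + of_bool (l = k) :: nat"
  let ?m = "\<lambda>l. \<integral>x. normal_density 0 \<tau> x * x ^ ?n l \<partial>lborel"
  have "(\<Prod>l\<in>UNIV. e l ^ ?n l) = e j * e k" for e :: "'j \<Rightarrow> real"
    by (simp add: power_add prod.distrib prod.delta of_bool_def if_distrib[of "\<lambda>n. _ ^ n"] cong: if_cong)
  moreover have "(\<Prod>l\<in>UNIV. ?m l) = (if j = k then \<tau>\<^sup>2 else 0)"
  proof (cases "j = k")
    case True
    have "?m l = (if l = j then \<tau>\<^sup>2 else 1)" for l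
      using integral_normal_moment_even[OF assms, of 0 1] integral_normal_density[OF assms] True
      by (simp add: eval_nat_numeral)
    then show ?thesis using True by (simp add: prod.delta)
  next
    case False
    then have "?m j = 0"
      using integral_normal_moment_odd[OF assms, of 0 0] by simp
    then show ?thesis using False by (auto intro!: prod_zero)
  qed
  ultimately show ?thesis
    using gaussian_noise_monomial[OF assms, of ?n] by (simp only:)
qed

text \<open>Both the Fisher information matrix and the information along a line are second moments of
  affine functions of the residuals, so this one formula evaluates them all.\<close>

lemma observation_law_product_moment:
  fixes X :: "real^'r^('n1::finite + 'n2::finite)" and Y :: "real^'r^('t1::finite + 't2::finite)"
    and c d :: "'t1 + 'n1 \<Rightarrow> real"
  assumes "0 < \<tau>"
  shows "has_bochner_integral (observation_law \<tau> X Y \<theta>)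
    (\<lambda>z. (\<alpha> + (\<Sum>j\<in>UNIV. c j * (z j - signal X Y \<theta> j))) *
         (\<beta> + (\<Sum>j\<in>UNIV. d j * (z j - signal X Y \<theta> j))))
    (\<alpha> * \<beta> + \<tau>\<^sup>2 * (\<Sum>j\<in>UNIV. c j * d j))"
proof -
  let ?G = "gaussian_noise \<tau> :: ('t1 + 'n1 \<Rightarrow> real) measure"
  interpret P: product_prob_space "\<lambda>_::'t1 + 'n1. density lborel (\<lambda>e. ennreal (normal_density 0 \<tau> e))" UNIV
    by (intro product_prob_spaceI prob_space_normal_density assms)
  interpret G: prob_space ?G
    unfolding gaussian_noise_def by (rule P.prob_space_axioms)
  have const: "has_bochner_integral ?G (\<lambda>e. \<alpha> * \<beta>) (\<alpha> * \<beta>)"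
    by (simp add: has_bochner_integral_iff G.prob_space)
  have lin: "has_bochner_integral ?G (\<lambda>e. a * (\<Sum>j\<in>UNIV. f j * e j)) (a * (\<Sum>j\<in>UNIV. f j * 0))"
    for a f
    by (intro has_bochner_integral_mult_right has_bochner_integral_sum gaussian_noise_mean assms)
  have quad: "has_bochner_integral ?G (\<lambda>e. \<Sum>j\<in>UNIV. \<Sum>k\<in>UNIV. (c k * d j) * (e j * e k))
      (\<Sum>j\<in>UNIV. \<Sum>k\<in>UNIV. (c k * d j) * (if j = k then \<tau>\<^sup>2 else 0))"
    by (intro has_bochner_integral_mult_right has_bochner_integral_sum gaussian_noise_covariance assms)
  have "has_bochner_integral ?G
      (\<lambda>e. (\<alpha> + (\<Sum>j\<in>UNIV. c j * e j)) * (\<beta> + (\<Sum>j\<in>UNIV. d j * e j)))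
      (\<alpha> * \<beta> + \<tau>\<^sup>2 * (\<Sum>j\<in>UNIV. c j * d j))"
    using has_bochner_integral_add[OF has_bochner_integral_add[OF has_bochner_integral_add[OF const lin] lin] quad,
        of \<alpha> d \<beta> c]
    by (simp add: sum_product algebra_simps sum_distrib_left if_distrib sum.delta cong: if_cong)
  moreover have "(\<lambda>e j. signal X Y \<theta> j + e j) \<in> ?G \<rightarrow>\<^sub>M Pi\<^sub>M UNIV (\<lambda>_. borel)"
    unfolding gaussian_noise_def by (rule measurable_PiM_single') (auto simp: space_PiM PiE_def)
  ultimately show ?thesis
    unfolding observation_law_def by (subst has_bochner_integral_distr) auto
qed

section \<open>Fisher information\<close>

lemma gradient_eqI:
  assumes "GDERIV f \<theta> :> D"
  shows "gradient f \<theta> = D"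
  unfolding gradient_def
proof (rule the_equality)
  fix D' assume "GDERIV f \<theta> :> D'"
  then have "(\<lambda>h. h \<bullet> D') = (\<lambda>h. h \<bullet> D)"
    using assms unfolding gderiv_def by (rule has_derivative_unique)
  then show "D' = D"
    by (metis vector_eq_ldot)
qed (fact assms)

lemma gradient_log_likelihood:
  assumes "0 < \<tau>"
  shows "gradient (\<lambda>\<theta>. ln (likelihood \<tau> X Y \<theta> z)) \<theta> =
    (\<Sum>j\<in>UNIV. ((z j - signal X Y \<theta> j) / \<tau>\<^sup>2) *\<^sub>R design_row X Y j)"
proof (rule gradient_eqI)
  obtain C :: real where "0 < C" and C: "\<And>\<theta>. likelihood \<tau> X Y \<theta> z =
      C * exp (- (\<Sum>j\<in>UNIV. (z j - signal X Y \<theta> j)\<^sup>2) / (2 * \<tau>\<^sup>2))"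
    using assms by (fastforce simp: likelihood_eq_exp)
  have "((\<lambda>\<theta>. ln C + - (\<Sum>j\<in>UNIV. (z j - design_row X Y j \<bullet> \<theta>)\<^sup>2) / (2 * \<tau>\<^sup>2)) has_derivative
      (\<lambda>h. h \<bullet> (\<Sum>j\<in>UNIV. ((z j - signal X Y \<theta> j) / \<tau>\<^sup>2) *\<^sub>R design_row X Y j))) (at \<theta>)"
    by (rule derivative_eq_intros refl | simp)+
      (use assms in \<open>auto simp: fun_eq_iff inner_sum_right sum_divide_distrib signal_eq_inner
        inner_commute sum_negf[symmetric] intro!: sum.cong\<close>)
  then show "GDERIV (\<lambda>\<theta>. ln (likelihood \<tau> X Y \<theta> z)) \<theta> :>
      (\<Sum>j\<in>UNIV. ((z j - signal X Y \<theta> j) / \<tau>\<^sup>2) *\<^sub>R design_row X Y j)"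
    using \<open>0 < C\<close> by (simp add: gderiv_def C ln_mult signal_eq_inner)
qed

lemma fisher_information_entry:
  assumes "0 < \<tau>"
  shows "fisher_information (\<Pi>\<^sub>M j\<in>UNIV. lborel) (likelihood \<tau> X Y) \<theta> $ a $ b =
    (\<Sum>j\<in>UNIV. design_row X Y j $ a * design_row X Y j $ b) / \<tau>\<^sup>2"
proof -
  have score: "gradient (\<lambda>\<theta>. ln (likelihood \<tau> X Y \<theta> z)) \<theta> $ a =
      0 + (\<Sum>j\<in>UNIV. (design_row X Y j $ a / \<tau>\<^sup>2) * (z j - signal X Y \<theta> j))" for z a
    by (simp add: gradient_log_likelihood[OF assms] mult.commute)
  have "fisher_information (\<Pi>\<^sub>M j\<in>UNIV. lborel) (likelihood \<tau> X Y) \<theta> $ a $ b =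
      \<tau>\<^sup>2 * (\<Sum>j\<in>UNIV. (design_row X Y j $ a / \<tau>\<^sup>2) * (design_row X Y j $ b / \<tau>\<^sup>2))"
    using has_bochner_integral_integral_eq[OF observation_law_product_moment[OF assms,
        of X Y \<theta> 0 _ 0], of "\<lambda>j. design_row X Y j $ a / \<tau>\<^sup>2" "\<lambda>j. design_row X Y j $ b / \<tau>\<^sup>2"]
    by (simp only: fisher_information_def vec_lambda_beta score
        observation_law_eq_density[OF assms, symmetric])
  also have "\<dots> = (\<Sum>j\<in>UNIV. design_row X Y j $ a * design_row X Y j $ b) / \<tau>\<^sup>2"
    using assms by (simp add: sum_distrib_left sum_divide_distrib power2_eq_square field_simps)
  finally show ?thesis .
qed

text \<open>As a bilinear form the information is the Gram form of the signal. Arguing with the form avoids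
  any block decomposition of the matrix itself.\<close>

lemma inner_fisher_information:
  assumes "0 < \<tau>"
  shows "h \<bullet> (fisher_information (\<Pi>\<^sub>M j\<in>UNIV. lborel) (likelihood \<tau> X Y) \<theta> *v h') =
    (\<Sum>j\<in>UNIV. signal X Y h j * signal X Y h' j) / \<tau>\<^sup>2"
proof -
  let ?a = "design_row X Y"
  have "fisher_information (\<Pi>\<^sub>M j\<in>UNIV. lborel) (likelihood \<tau> X Y) \<theta> *v h' =
      (\<Sum>j\<in>UNIV. (signal X Y h' j / \<tau>\<^sup>2) *\<^sub>R ?a j)"
    by (simp add: vec_eq_iff matrix_vector_mult_def fisher_information_entry[OF assms] 
        signal_eq_inner inner_vec_def sum_distrib_right sum_divide_distrib)
       (subst sum.swap, simp add: mult_ac)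
  then show ?thesis
    by (simp add: inner_sum_right signal_eq_inner inner_commute mult_ac sum_divide_distrib)
qed

section \<open>The van Trees inequality along a line\<close>

text \<open>The prior on \<open>[-\<delta>, \<delta>]\<close> has density \<open>(prior_root \<delta>)\<^sup>2\<close>. Among densities vanishing at both end
  points the squared cosine has the least Fisher information, \<open>\<pi>\<^sup>2 / \<delta>\<^sup>2\<close>, which is where the
  constant \<open>\<pi>\<^sup>2\<close> of the risk bound comes from. Working with the square root keeps the
  information \<open>4 (prior_root_deriv \<delta>)\<^sup>2\<close> free of division by a vanishing density.\<close>

definition prior_root :: "real \<Rightarrow> real \<Rightarrow> real" where
  "prior_root \<delta> s = cos (pi * s / (2 * \<delta>)) / sqrt \<delta>"

definition prior_root_deriv :: "real \<Rightarrow> real \<Rightarrow> real" where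
  "prior_root_deriv \<delta> s = - (pi / (2 * \<delta>)) * sin (pi * s / (2 * \<delta>)) / sqrt \<delta>"

lemma DERIV_prior_root:
  assumes "0 < \<delta>"
  shows "(prior_root \<delta> has_real_derivative prior_root_deriv \<delta> s) (at s)"
  unfolding prior_root_def[abs_def] prior_root_deriv_def
  by (rule DERIV_cdivide) (use assms in \<open>auto intro!: derivative_eq_intros\<close>)

lemma prior_root_boundary:
  assumes "0 < \<delta>"
  shows "prior_root \<delta> \<delta> = 0" and "prior_root \<delta> (- \<delta>) = 0"
  using assms by (simp_all add: prior_root_def)

lemma continuous_on_prior_root [continuous_intros]:
  "continuous_on S (prior_root \<delta>)" "continuous_on S (prior_root_deriv \<delta>)"
  unfolding prior_root_def[abs_def] prior_root_deriv_def[abs_def] divide_inverse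
  by (intro continuous_intros)+

lemma measurable_prior_root [measurable]:
  "prior_root \<delta> \<in> borel_measurable borel" "prior_root_deriv \<delta> \<in> borel_measurable borel"
  by (intro borel_measurable_continuous_onI continuous_on_prior_root)+

text \<open>The squared cosine is even, so the odd term \<open>b s\<close> integrates to zero: only the slope of the
  target at the centre of the line survives averaging. The choices \<open>c = 0\<close> and \<open>c = 4\<close> give
  prior expectations and the prior information.\<close>

lemma nn_integral_prior_root:
  assumes "0 < \<delta>"
    and nonneg: "\<And>s. s \<in> {-\<delta>..\<delta>} \<Longrightarrow> 0 \<le> (a + b * s) * (prior_root \<delta> s)\<^sup>2 + c * (prior_root_deriv \<delta> s)\<^sup>2"
  shows "(\<integral>\<^sup>+s\<in>{-\<delta>..\<delta>}. ennreal ((a + b * s) * (prior_root \<delta> s)\<^sup>2 + c * (prior_root_deriv \<delta> s)\<^sup>2) \<partial>lborel)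
    = ennreal (a + c * pi\<^sup>2 / (4 * \<delta>\<^sup>2))"
proof -
  define w where "w = pi / \<delta>"
  have "w > 0" using assms(1) by (simp add: w_def)
  have root: "(prior_root \<delta> s)\<^sup>2 = (1 + cos (w * s)) / (2 * \<delta>)" for s
    using cos_double_cos[of "pi * s / (2 * \<delta>)"] assms(1)
    by (simp add: prior_root_def power_divide w_def field_simps)
  have deriv: "(prior_root_deriv \<delta> s)\<^sup>2 = (w / 2)\<^sup>2 * (1 - cos (w * s)) / (2 * \<delta>)" for s
  proof -
    have cos: "cos (w * s) = 1 - 2 * (sin (pi * s / (2 * \<delta>)))\<^sup>2"
      using cos_double_sin[of "pi * s / (2 * \<delta>)"] by (simp add: w_def)
    show ?thesis
      unfolding cos using assms(1)
      by (simp add: prior_root_deriv_def power_divide power_mult_distrib w_def)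
  qed
  define S where "S s = sin (w * s) / w" for s
  define C where "C s = cos (w * s) / w\<^sup>2" for s
  define F where "F s = (a * (s + S s) + b * (s * s / 2 + s * S s + C s) + c * (w / 2)\<^sup>2 * (s - S s)) / (2 * \<delta>)" for s
  have S: "(S has_real_derivative cos (w * s)) (at s)" for s
    unfolding S_def[abs_def] by (rule DERIV_cdivide[THEN DERIV_cong]) (use \<open>w > 0\<close> in \<open>auto intro!: derivative_eq_intros\<close>)
  have C: "(C has_real_derivative - S s) (at s)" for s
    unfolding C_def[abs_def] S_def
    by (rule DERIV_cdivide[THEN DERIV_cong])
       (use \<open>w > 0\<close> in \<open>auto intro!: derivative_eq_intros simp: power2_eq_square\<close>)
  have "(F has_real_derivative (a * (1 + cos (w * s)) + b * ((1 * s + 1 * s) / 2 + (1 * S s + cos (w * s) * s) + - S s)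
      + c * (w / 2)\<^sup>2 * (1 - cos (w * s))) / (2 * \<delta>)) (at s)" for s
    unfolding F_def[abs_def]
    by (rule DERIV_cdivide DERIV_add DERIV_diff DERIV_cmult DERIV_mult DERIV_ident S C)+
  then have "(F has_real_derivative (a + b * s) * (prior_root \<delta> s)\<^sup>2 + c * (prior_root_deriv \<delta> s)\<^sup>2) (at s)" for s
    by (rule DERIV_cong) (simp add: root deriv add_divide_distrib[symmetric] algebra_simps)
  then have "(\<integral>\<^sup>+s\<in>{-\<delta>..\<delta>}. ennreal ((a + b * s) * (prior_root \<delta> s)\<^sup>2 + c * (prior_root_deriv \<delta> s)\<^sup>2) \<partial>lborel)
      = ennreal (F \<delta> - F (- \<delta>))"
    using assms by (intro nn_integral_FTC_Icc) auto
  also have "F \<delta> - F (- \<delta>) = a + c * pi\<^sup>2 / (4 * \<delta>\<^sup>2)"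
  proof -
    have "w * \<delta> = pi" using assms(1) by (simp add: w_def)
    then show ?thesis
      using assms(1) by (simp add: F_def S_def C_def) (simp add: w_def field_simps power2_eq_square)
  qed
  finally show ?thesis .
qed

text \<open>Integration by parts in the form of an inequality: an exact derivative whose primitive agrees at
  the end points contributes nothing.\<close>

lemma nn_integral_mono_modulo_derivative:
  fixes f g \<phi> \<Phi> :: "real \<Rightarrow> real"
  assumes "a \<le> b"
    and cont: "continuous_on {a..b} f" "continuous_on {a..b} g" "continuous_on {a..b} \<phi>"
    and nonneg: "\<And>s. s \<in> {a..b} \<Longrightarrow> 0 \<le> f s" "\<And>s. s \<in> {a..b} \<Longrightarrow> 0 \<le> g s"
    and deriv: "\<And>s. (\<Phi> has_real_derivative \<phi> s) (at s)"
    and "\<Phi> a = \<Phi> b"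
    and le: "\<And>s. s \<in> {a..b} \<Longrightarrow> f s + \<phi> s \<le> g s"
  shows "(\<integral>\<^sup>+s\<in>{a..b}. ennreal (f s) \<partial>lborel) \<le> (\<integral>\<^sup>+s\<in>{a..b}. ennreal (g s) \<partial>lborel)"
proof -
  let ?I = "\<lambda>u. \<integral>s. indicator {a..b} s *\<^sub>R u s \<partial>lborel"
  have int: "integrable lborel (\<lambda>s. indicator {a..b} s *\<^sub>R u s)" if "continuous_on {a..b} u" for u :: "real \<Rightarrow> real"
    using borel_integrable_atLeastAtMost'[OF that] by (simp add: set_integrable_def)
  have nn: "(\<integral>\<^sup>+s\<in>{a..b}. ennreal (u s) \<partial>lborel) = ennreal (?I u)"
    if "continuous_on {a..b} u" "\<And>s. s \<in> {a..b} \<Longrightarrow> 0 \<le> u s" for u :: "real \<Rightarrow> real"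
  proof -
    have "(\<integral>\<^sup>+s\<in>{a..b}. ennreal (u s) \<partial>lborel) = (\<integral>\<^sup>+s. ennreal (indicator {a..b} s *\<^sub>R u s) \<partial>lborel)"
      by (intro nn_integral_cong) (auto split: split_indicator)
    also have "\<dots> = ennreal (?I u)"
      using that by (intro nn_integral_eq_integral int) (auto split: split_indicator)
    finally show ?thesis .
  qed
  have "?I \<phi> = \<Phi> b - \<Phi> a"
    using deriv by (intro integral_FTC_atLeastAtMost assms)
      (auto simp: has_real_derivative_iff_has_vector_derivative[symmetric] intro: has_field_derivative_at_within)
  then have "?I f = ?I f + ?I \<phi>"
    using \<open>\<Phi> a = \<Phi> b\<close> by simp
  also have "\<dots> = ?I (\<lambda>s. f s + \<phi> s)"
    using int[OF cont(1)] int[OF cont(3)]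
    by (simp only: scaleR_add_right Bochner_Integration.integral_add)
  also have "\<dots> \<le> ?I g"
    using le cont by (intro integral_mono int continuous_intros) (auto split: split_indicator)
  finally show ?thesis
    using nn cont nonneg by (simp add: ennreal_leI)
qed

lemma likelihood_line:
  fixes X :: "real^'r^('n1::finite + 'n2::finite)" and Y :: "real^'r^('t1::finite + 't2::finite)"
  shows "likelihood \<tau> X Y (\<theta> + s *\<^sub>R h) z =
    (1 / sqrt (2 * pi * \<tau>\<^sup>2)) ^ CARD('t1 + 'n1) *
    exp (- (\<Sum>j\<in>UNIV. (z j - (signal X Y \<theta> j + s * signal X Y h j))\<^sup>2) / (2 * \<tau>\<^sup>2))"
  by (simp add: likelihood_eq_exp signal_add_scaleR)

definition line_score ::
  "real \<Rightarrow> real^'r^('n1::finite + 'n2::finite) \<Rightarrow> real^'r^('t1::finite + 't2::finite) \<Rightarrow>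
   real^('r + 'r) \<Rightarrow> real^('r + 'r) \<Rightarrow> real \<Rightarrow> ('t1 + 'n1 \<Rightarrow> real) \<Rightarrow> real" where
  "line_score \<tau> X Y \<theta> h s z =
     (\<Sum>j\<in>UNIV. signal X Y h j * (z j - (signal X Y \<theta> j + s * signal X Y h j))) / \<tau>\<^sup>2"

lemma DERIV_likelihood_line:
  "((\<lambda>s. likelihood \<tau> X Y (\<theta> + s *\<^sub>R h) z) has_real_derivative
    likelihood \<tau> X Y (\<theta> + s *\<^sub>R h) z * line_score \<tau> X Y \<theta> h s z) (at s)"
proof -
  let ?m = "signal X Y \<theta>" and ?b = "signal X Y h"
  have "((\<lambda>s. \<Sum>j\<in>UNIV. (z j - (?m j + s * ?b j))\<^sup>2) has_real_derivative
      - 2 * (\<Sum>j\<in>UNIV. ?b j * (z j - (?m j + s * ?b j)))) (at s)"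
    by (rule derivative_eq_intros refl | simp)+
      (simp add: sum_distrib_left sum_negf[symmetric] mult_ac)
  from DERIV_cdivide[OF DERIV_minus[OF this], of "2 * \<tau>\<^sup>2"]
  have *: "((\<lambda>s. - (\<Sum>j\<in>UNIV. (z j - (?m j + s * ?b j))\<^sup>2) / (2 * \<tau>\<^sup>2)) has_real_derivative
      line_score \<tau> X Y \<theta> h s z) (at s)"
    by (simp add: line_score_def)
  show ?thesis
    unfolding likelihood_line
    by (rule derivative_eq_intros * refl)+ simp
qed

lemma nn_integral_likelihood:
  assumes "0 < \<tau>" and [measurable]: "f \<in> borel_measurable (\<Pi>\<^sub>M j\<in>UNIV. borel)"
    and "\<And>z. 0 \<le> f z"
  shows "(\<integral>\<^sup>+z. ennreal (likelihood \<tau> X Y \<theta> z * f z) \<partial>(\<Pi>\<^sub>M j\<in>UNIV. lborel)) =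
    (\<integral>\<^sup>+z. ennreal (f z) \<partial>observation_law \<tau> X Y \<theta>)"
proof -
  have [measurable_cong]: "sets (\<Pi>\<^sub>M j\<in>UNIV. (lborel :: real measure)) = sets (\<Pi>\<^sub>M j\<in>UNIV. borel)"
    by (intro sets_PiM_cong) auto
  have [measurable]: "likelihood \<tau> X Y \<theta> \<in> borel_measurable (\<Pi>\<^sub>M j\<in>UNIV. borel)"
    unfolding likelihood_def[abs_def] by measurable
  have "0 \<le> likelihood \<tau> X Y \<theta> z" for z
    using likelihood_pos[OF assms(1)] by (rule less_imp_le)
  then show ?thesis
    using assms by (simp add: observation_law_eq_density nn_integral_density ennreal_mult)
qed

text \<open>Write \<open>p\<close> for the likelihood along the line, \<open>l\<close> for its score and \<open>q\<^sup>2\<close> for the prior density. For a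
  fixed observation,
  \<open>(est - \<psi>)\<^sup>2 p q\<^sup>2 + p (l q + 2 q')\<^sup>2 \<ge> 2 (est - \<psi>) p q (l q + 2 q')\<close>,
  and the right-hand side is \<open>2 (est - \<psi>)\<close> times the derivative of \<open>p q\<^sup>2\<close>. Integrating it by parts
  in \<open>s\<close> leaves \<open>2 \<psi>' p q\<^sup>2\<close>, because \<open>q\<close> vanishes at \<open>\<plusminus>\<delta>\<close>. Averaging over the observation turns the
  first term into the Bayes risk, the second into the information of the model plus that of the
  prior, and the right-hand side into \<open>2 g\<close>.

  The usual van Trees inequality \<open>g\<^sup>2 / (J + \<pi>\<^sup>2 / \<delta>\<^sup>2)\<close>, with \<open>J\<close> the model information, follows by
  Cauchy--Schwarz instead; when \<open>g = J\<close>, the linear form here is its first-order expansion in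
  \<open>\<pi>\<^sup>2 / (g \<delta>\<^sup>2)\<close>. The integration by parts takes place for each observation separately, so it never
  meets the dependence of the estimator on the observation.\<close>

lemma van_trees_line:
  fixes X :: "real^'r^('n1::finite + 'n2::finite)" and Y :: "real^'r^('t1::finite + 't2::finite)"
    and est :: "('t1 + 'n1 \<Rightarrow> real) \<Rightarrow> real"
  assumes "0 < \<tau>" "0 < \<delta>"
    and est: "est \<in> borel_measurable (\<Pi>\<^sub>M j\<in>UNIV. borel)"
    and risk: "\<And>s. \<bar>s\<bar> \<le> \<delta> \<Longrightarrow>
      (\<integral>\<^sup>+z. ennreal ((est z - (\<psi>\<^sub>0 + g * s + \<kappa> * s\<^sup>2))\<^sup>2) \<partial>observation_law \<tau> X Y (\<theta> + s *\<^sub>R h)) \<le> R"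
  shows "ennreal (2 * g - (\<Sum>j\<in>UNIV. (signal X Y h j)\<^sup>2) / \<tau>\<^sup>2 - pi\<^sup>2 / \<delta>\<^sup>2) \<le> R"
proof -
  note est [measurable]
  let ?L = "(\<Pi>\<^sub>M j\<in>UNIV. lborel) :: ('t1 + 'n1 \<Rightarrow> real) measure"
  define p where "p s z = likelihood \<tau> X Y (\<theta> + s *\<^sub>R h) z" for s z
  define l where "l s z = line_score \<tau> X Y \<theta> h s z" for s z
  define q where "q = prior_root \<delta>"
  define q' where "q' = prior_root_deriv \<delta>"
  define \<psi> where "\<psi> s = \<psi>\<^sub>0 + g * s + \<kappa> * s\<^sup>2" for s
  define \<psi>' where "\<psi>' s = g + 2 * \<kappa> * s" for s
  define J where "J = (\<Sum>j\<in>UNIV. (signal X Y h j)\<^sup>2) / \<tau>\<^sup>2"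
  define K where "K = \<bar>g\<bar> + 2 * \<bar>\<kappa>\<bar> * \<delta>"
  have "0 \<le> K" "0 \<le> J" using assms by (simp_all add: K_def J_def sum_nonneg)
  have K: "0 \<le> \<psi>' s + K" if "s \<in> {-\<delta>..\<delta>}" for s
  proof -
    have "\<bar>\<kappa> * s\<bar> \<le> \<bar>\<kappa>\<bar> * \<delta>"
      using that by (auto simp: abs_mult intro!: mult_left_mono)
    then show ?thesis by (simp add: \<psi>'_def K_def)
  qed
  define A where "A s z = p s z * ((est z - \<psi> s)\<^sup>2 * (q s)\<^sup>2 + (l s z * q s + 2 * q' s)\<^sup>2 + 2 * K * (q s)\<^sup>2)" for s z
  define B where "B s z = p s z * (2 * (\<psi>' s + K) * (q s)\<^sup>2)" for s z
  have p_pos: "0 < p s z" for s z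
    by (simp add: p_def likelihood_pos assms)
  have Dp: "((\<lambda>s. p s z) has_real_derivative p s z * l s z) (at s)" for s z
    unfolding p_def l_def by (rule DERIV_likelihood_line)
  have Dq: "(q has_real_derivative q' s) (at s)" for s
    unfolding q_def q'_def by (rule DERIV_prior_root) fact
  have D\<psi>: "(\<psi> has_real_derivative \<psi>' s) (at s)" for s
    unfolding \<psi>_def[abs_def] \<psi>'_def by (auto intro!: derivative_eq_intros)
  have cont_p: "continuous_on S (\<lambda>s. p s z)" for S z
    using Dp by (meson DERIV_continuous continuous_at_imp_continuous_on)
  have cont_l: "continuous_on S (\<lambda>s. l s z)" for S z
    unfolding l_def line_score_def divide_inverse by (intro continuous_intros)
  have cont_q: "continuous_on S q" "continuous_on S q'" for S
    unfolding q_def q'_def by (rule continuous_on_prior_root)+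
  have cont_\<psi>: "continuous_on S \<psi>" "continuous_on S \<psi>'" for S
    unfolding \<psi>_def[abs_def] \<psi>'_def[abs_def] by (intro continuous_intros)+
  note cont = cont_p cont_l cont_q cont_\<psi>

  \<comment> \<open>\<open>\<psi>'\<close> may change sign on the interval. Adding \<open>2 K p q\<^sup>2\<close> to both sides makes both integrands
    nonnegative, so that Tonelli's theorem applies to any measurable estimator.\<close>
  have pointwise: "(\<integral>\<^sup>+s\<in>{-\<delta>..\<delta>}. ennreal (B s z) \<partial>lborel) \<le> (\<integral>\<^sup>+s\<in>{-\<delta>..\<delta>}. ennreal (A s z) \<partial>lborel)" for z
  proof (rule nn_integral_mono_modulo_derivative)
    let ?\<Phi> = "\<lambda>s. 2 * (est z - \<psi> s) * (p s z * (q s)\<^sup>2)"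
    let ?\<phi> = "\<lambda>s. 2 * (est z - \<psi> s) * (p s z * q s * (l s z * q s + 2 * q' s)) - 2 * \<psi>' s * (p s z * (q s)\<^sup>2)"
    show "(?\<Phi> has_real_derivative ?\<phi> s) (at s)" for s
      by (rule derivative_eq_intros Dp Dq D\<psi> refl)+ (simp add: algebra_simps power2_eq_square)
    show "?\<Phi> (- \<delta>) = ?\<Phi> \<delta>"
      by (simp add: q_def prior_root_boundary assms)
    show "continuous_on {-\<delta>..\<delta>} (\<lambda>s. B s z)" "continuous_on {-\<delta>..\<delta>} (\<lambda>s. A s z)" "continuous_on {-\<delta>..\<delta>} ?\<phi>"
      unfolding A_def B_def by (intro continuous_intros cont)+
    show "0 \<le> B s z" if "s \<in> {-\<delta>..\<delta>}" for s
      using K[OF that] p_pos[of s z] by (simp add: B_def)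
    show "0 \<le> A s z" for s
      using \<open>0 \<le> K\<close> p_pos[of s z] by (simp add: A_def)
    show "B s z + ?\<phi> s \<le> A s z" for s
    proof -
      have "A s z - (B s z + ?\<phi> s) = p s z * ((est z - \<psi> s) * q s - (l s z * q s + 2 * q' s))\<^sup>2"
        by (simp add: A_def B_def algebra_simps power2_eq_square)
      also have "\<dots> \<ge> 0" using p_pos[of s z] by simp
      finally show ?thesis by simp
    qed
  qed (use assms in auto)

  interpret L: product_sigma_finite "\<lambda>_::'t1 + 'n1. lborel :: real measure" by standard
  interpret L: sigma_finite_measure ?L by (rule L.sigma_finite) simp
  interpret pair_sigma_finite "lborel :: real measure" ?L ..
  have [measurable_cong]: "sets ?L = sets (\<Pi>\<^sub>M j\<in>UNIV. borel)"
    by (intro sets_PiM_cong) auto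
  have [measurable]: "(\<lambda>(s, z). p s z) \<in> borel_measurable (borel \<Otimes>\<^sub>M (\<Pi>\<^sub>M j\<in>UNIV. borel))"
    "(\<lambda>(s, z). l s z) \<in> borel_measurable (borel \<Otimes>\<^sub>M (\<Pi>\<^sub>M j\<in>UNIV. borel))"
    unfolding p_def likelihood_line l_def line_score_def by measurable
  have [measurable]: "q \<in> borel_measurable borel" "q' \<in> borel_measurable borel"
    "\<psi> \<in> borel_measurable borel" "\<psi>' \<in> borel_measurable borel"
    by (intro borel_measurable_continuous_onI cont)+
  have AB [measurable]: "(\<lambda>(s, z). A s z) \<in> borel_measurable (lborel \<Otimes>\<^sub>M ?L)"
    "(\<lambda>(s, z). B s z) \<in> borel_measurable (lborel \<Otimes>\<^sub>M ?L)"
    unfolding A_def B_def by measurable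
  have swap: "(\<integral>\<^sup>+z. (\<integral>\<^sup>+s\<in>{-\<delta>..\<delta>}. ennreal (u s z) \<partial>lborel) \<partial>?L) =
      (\<integral>\<^sup>+s\<in>{-\<delta>..\<delta>}. (\<integral>\<^sup>+z. ennreal (u s z) \<partial>?L) \<partial>lborel)"
    if [measurable]: "(\<lambda>(s, z). u s z) \<in> borel_measurable (lborel \<Otimes>\<^sub>M ?L)" for u
  proof -
    have "(\<integral>\<^sup>+z. (\<integral>\<^sup>+s\<in>{-\<delta>..\<delta>}. ennreal (u s z) \<partial>lborel) \<partial>?L) =
        (\<integral>\<^sup>+s. (\<integral>\<^sup>+z. ennreal (u s z) * indicator {-\<delta>..\<delta>} s \<partial>?L) \<partial>lborel)"
      by (rule Fubini') measurable
    also have "\<dots> = (\<integral>\<^sup>+s\<in>{-\<delta>..\<delta>}. (\<integral>\<^sup>+z. ennreal (u s z) \<partial>?L) \<partial>lborel)"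
      by (intro nn_integral_cong nn_integral_multc) measurable
    finally show ?thesis .
  qed

  have B_mean: "(\<integral>\<^sup>+z. ennreal (B s z) \<partial>?L) = ennreal ((2 * (g + K) + 4 * \<kappa> * s) * (q s)\<^sup>2 + 0 * (q' s)\<^sup>2)"
    if "s \<in> {-\<delta>..\<delta>}" for s
  proof -
    have "(\<integral>\<^sup>+z. ennreal (B s z) \<partial>?L) =
        (\<integral>\<^sup>+z. ennreal (2 * (\<psi>' s + K) * (q s)\<^sup>2) \<partial>observation_law \<tau> X Y (\<theta> + s *\<^sub>R h))"
      unfolding B_def p_def
      by (rule nn_integral_likelihood) (use K[OF that] assms in auto)
    also have "\<dots> = ennreal (2 * (\<psi>' s + K) * (q s)\<^sup>2)"
      by (simp add: prob_space.emeasure_space_1[OF prob_space_observation_law[OF \<open>0 < \<tau>\<close>]])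
    finally show ?thesis by (simp add: \<psi>'_def algebra_simps)
  qed
  have A_mean: "(\<integral>\<^sup>+z. ennreal (A s z) \<partial>?L) \<le>
      ennreal ((q s)\<^sup>2) * R + ennreal ((J + 2 * K + 0 * s) * (q s)\<^sup>2 + 4 * (q' s)\<^sup>2)"
    if s: "s \<in> {-\<delta>..\<delta>}" for s
  proof -
    let ?O = "observation_law \<tau> X Y (\<theta> + s *\<^sub>R h)"
    let ?u = "\<lambda>z. (l s z * q s + 2 * q' s)\<^sup>2 + 2 * K * (q s)\<^sup>2"
    have [measurable_cong]: "sets ?O = sets (\<Pi>\<^sub>M j\<in>UNIV. borel)"
      by (simp add: observation_law_def)
    have "(\<integral>\<^sup>+z. ennreal (A s z) \<partial>?L) =
        (\<integral>\<^sup>+z. ennreal ((est z - \<psi> s)\<^sup>2 * (q s)\<^sup>2 + (l s z * q s + 2 * q' s)\<^sup>2 + 2 * K * (q s)\<^sup>2) \<partial>?O)"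
      unfolding A_def p_def
      by (rule nn_integral_likelihood) (use \<open>0 \<le> K\<close> assms in auto)
    also have "\<dots> = (\<integral>\<^sup>+z. ennreal ((q s)\<^sup>2) * ennreal ((est z - \<psi> s)\<^sup>2) + ennreal (?u z) \<partial>?O)"
      using \<open>0 \<le> K\<close>
      by (intro nn_integral_cong) (simp add: ennreal_mult[symmetric] ennreal_plus[symmetric] mult.commute add.assoc del: ennreal_plus)
    also have "\<dots> = ennreal ((q s)\<^sup>2) * (\<integral>\<^sup>+z. ennreal ((est z - \<psi> s)\<^sup>2) \<partial>?O) + (\<integral>\<^sup>+z. ennreal (?u z) \<partial>?O)"
      by (subst nn_integral_add, measurable) (subst nn_integral_cmult, measurable)
    also have "(\<integral>\<^sup>+z. ennreal (?u z) \<partial>?O) = ennreal ((J + 2 * K + 0 * s) * (q s)\<^sup>2 + 4 * (q' s)\<^sup>2)"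
    proof -
      let ?c = "\<lambda>j. signal X Y h j * q s / \<tau>\<^sup>2"
      have u: "2 * q' s + (\<Sum>j\<in>UNIV. ?c j * (z j - signal X Y (\<theta> + s *\<^sub>R h) j)) = l s z * q s + 2 * q' s" for z
        by (simp add: l_def line_score_def signal_add_scaleR sum_distrib_left sum_divide_distrib mult_ac)
      have v: "\<tau>\<^sup>2 * (\<Sum>j\<in>UNIV. ?c j * ?c j) = J * (q s)\<^sup>2"
        using assms(1)
        by (simp add: J_def sum_distrib_left sum_distrib_right sum_divide_distrib power2_eq_square field_simps)
      have "has_bochner_integral ?O (\<lambda>z. 2 * K * (q s)\<^sup>2) (2 * K * (q s)\<^sup>2)"
        by (simp add: has_bochner_integral_iff
            prob_space.prob_space[OF prob_space_observation_law[OF \<open>0 < \<tau>\<close>]]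
            prob_space.finite_measure[OF prob_space_observation_law[OF \<open>0 < \<tau>\<close>]]
            finite_measure.integrable_const)
      then have "has_bochner_integral ?O ?u ((J + 2 * K + 0 * s) * (q s)\<^sup>2 + 4 * (q' s)\<^sup>2)"
        using has_bochner_integral_add[OF observation_law_product_moment[OF assms(1),
              of X Y "\<theta> + s *\<^sub>R h" "2 * q' s" ?c "2 * q' s" ?c]]
        unfolding u v by (fastforce simp: algebra_simps power2_eq_square)
      then show ?thesis
        using \<open>0 \<le> K\<close> by (subst nn_integral_eq_integral) (auto simp: has_bochner_integral_iff)
    qed
    also have "ennreal ((q s)\<^sup>2) * (\<integral>\<^sup>+z. ennreal ((est z - \<psi> s)\<^sup>2) \<partial>?O) \<le> ennreal ((q s)\<^sup>2) * R"
      unfolding \<psi>_def using s by (intro mult_left_mono risk) auto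
    finally show ?thesis by (simp add: add_right_mono)
  qed

  have "ennreal (2 * (g + K)) = ennreal (2 * (g + K) + 0 * pi\<^sup>2 / (4 * \<delta>\<^sup>2))" by simp
  also have "\<dots> =
      (\<integral>\<^sup>+s\<in>{-\<delta>..\<delta>}. ennreal ((2 * (g + K) + 4 * \<kappa> * s) * (q s)\<^sup>2 + 0 * (q' s)\<^sup>2) \<partial>lborel)"
    unfolding q_def q'_def
  proof (rule nn_integral_prior_root[symmetric])
    show "0 \<le> (2 * (g + K) + 4 * \<kappa> * s) * (prior_root \<delta> s)\<^sup>2 + 0 * (prior_root_deriv \<delta> s)\<^sup>2"
      if "s \<in> {-\<delta>..\<delta>}" for s
      using K[OF that] by (simp add: \<psi>'_def)
  qed fact
  also have "\<dots> = (\<integral>\<^sup>+s\<in>{-\<delta>..\<delta>}. (\<integral>\<^sup>+z. ennreal (B s z) \<partial>?L) \<partial>lborel)"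
    using B_mean by (intro nn_integral_cong) (auto split: split_indicator)
  also have "\<dots> = (\<integral>\<^sup>+z. (\<integral>\<^sup>+s\<in>{-\<delta>..\<delta>}. ennreal (B s z) \<partial>lborel) \<partial>?L)"
    by (rule swap[symmetric]) (rule AB)
  also have "\<dots> \<le> (\<integral>\<^sup>+z. (\<integral>\<^sup>+s\<in>{-\<delta>..\<delta>}. ennreal (A s z) \<partial>lborel) \<partial>?L)"
    by (intro nn_integral_mono pointwise)
  also have "\<dots> = (\<integral>\<^sup>+s\<in>{-\<delta>..\<delta>}. (\<integral>\<^sup>+z. ennreal (A s z) \<partial>?L) \<partial>lborel)"
    by (rule swap) (rule AB)
  also have "\<dots> \<le> (\<integral>\<^sup>+s. R * (ennreal ((1 + 0 * s) * (q s)\<^sup>2 + 0 * (q' s)\<^sup>2) * indicator {-\<delta>..\<delta>} s) +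
      ennreal ((J + 2 * K + 0 * s) * (q s)\<^sup>2 + 4 * (q' s)\<^sup>2) * indicator {-\<delta>..\<delta>} s \<partial>lborel)"
    using A_mean by (intro nn_integral_mono) (auto split: split_indicator simp: mult.commute)
  also have "\<dots> = R * (\<integral>\<^sup>+s\<in>{-\<delta>..\<delta>}. ennreal ((1 + 0 * s) * (q s)\<^sup>2 + 0 * (q' s)\<^sup>2) \<partial>lborel) +
      (\<integral>\<^sup>+s\<in>{-\<delta>..\<delta>}. ennreal ((J + 2 * K + 0 * s) * (q s)\<^sup>2 + 4 * (q' s)\<^sup>2) \<partial>lborel)"
    by (subst nn_integral_add, measurable) (subst nn_integral_cmult, measurable)
  also have "\<dots> = R * ennreal (1 + 0 * pi\<^sup>2 / (4 * \<delta>\<^sup>2)) + ennreal (J + 2 * K + 4 * pi\<^sup>2 / (4 * \<delta>\<^sup>2))"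
    unfolding q_def q'_def using \<open>0 \<le> J\<close> \<open>0 \<le> K\<close>
    by (intro arg_cong2[where f = "(+)"] arg_cong2[where f = "(*)"] nn_integral_prior_root assms refl) auto
  finally have main: "ennreal (2 * (g + K)) \<le> R + ennreal (J + 2 * K + pi\<^sup>2 / \<delta>\<^sup>2)" by simp
  show ?thesis
  proof (cases R)
    case (real r)
    have "0 \<le> J + 2 * K + pi\<^sup>2 / \<delta>\<^sup>2"
      using \<open>0 \<le> J\<close> \<open>0 \<le> K\<close> by simp
    with main real have "2 * (g + K) \<le> r + (J + 2 * K + pi\<^sup>2 / \<delta>\<^sup>2)"
      by (simp add: ennreal_plus[symmetric] ennreal_le_iff del: ennreal_plus)
    then show ?thesis
      using real by (simp add: J_def ennreal_leI)
  qed simp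
qed

section \<open>Linear algebra of the scaled factors\<close>

lemma diag_mat_mult_vec: "(diag_mat d *v v) $ a = d $ a * v $ a"
  by (simp add: diag_mat_def matrix_vector_mult_def if_distrib[of "\<lambda>x. x * c" for c] sum.delta' cong: if_cong)

lemma inner_diag_mat: "v \<bullet> (diag_mat d *v w) = (diag_mat d *v v) \<bullet> w"
  by (simp add: inner_vec_def diag_mat_mult_vec mult_ac)

abbreviation sqrt_diag :: "real^'r \<Rightarrow> real^'r^'r" where
  "sqrt_diag \<sigma> \<equiv> diag_mat (\<chi> a. sqrt (\<sigma> $ a))"

abbreviation inv_sqrt_diag :: "real^'r \<Rightarrow> real^'r^'r" where
  "inv_sqrt_diag \<sigma> \<equiv> diag_mat (\<chi> a. 1 / sqrt (\<sigma> $ a))"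

lemma sqrt_diag_inverse:
  assumes "\<And>a. 0 < \<sigma> $ a"
  shows "sqrt_diag \<sigma> *v (inv_sqrt_diag \<sigma> *v v) = v"
proof -
  have "\<sigma> $ a \<noteq> 0" for a using assms[of a] by simp
  then show ?thesis by (simp add: vec_eq_iff diag_mat_mult_vec)
qed

lemma scaled_factor_row: "scaled_factor U \<sigma> $ k = sqrt_diag \<sigma> *v (U $ k)"
  by (simp add: vec_eq_iff scaled_factor_def diag_mat_mult_vec matrix_matrix_mult_def)
     (simp add: diag_mat_def if_distrib[of "\<lambda>x. c * x" for c] sum.delta mult.commute cong: if_cong)

lemma inner_gram_upper_rows:
  fixes U :: "real^'r^('n1::finite + 'n2::finite)"
  shows "v \<bullet> ((transpose (upper_rows U) ** upper_rows U) *v w) =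
    (\<Sum>k\<in>UNIV. (U $ Inl k \<bullet> v) * (U $ Inl k \<bullet> w))"
proof -
  have "v \<bullet> ((transpose (upper_rows U) ** upper_rows U) *v w) = (upper_rows U *v v) \<bullet> (upper_rows U *v w)"
    by (simp add: matrix_vector_mul_assoc[symmetric] transpose_matrix_vector inner_commute[of v] dot_lmul_matrix)
       (rule inner_commute)
  then show ?thesis
    unfolding inner_vec_def[of "upper_rows U *v v"]
    by (simp add: matrix_vector_mul_component upper_rows_def)
qed

lemma matrix_inv_mult_vec:
  fixes A :: "real^'n^'n"
  assumes "invertible A"
  shows "A *v (matrix_inv A *v b) = b" and "matrix_inv A *v (A *v b) = b"
proof -
  have "A ** matrix_inv A = mat 1 \<and> matrix_inv A ** A = mat 1"
    using assms unfolding invertible_def matrix_inv_def by (rule someI_ex)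
  then show "A *v (matrix_inv A *v b) = b" and "matrix_inv A *v (A *v b) = b"
    by (simp_all add: matrix_vector_mul_assoc)
qed

lemma invertible_if_solvable:
  fixes A :: "real^'n^'n"
  assumes "\<And>b. \<exists>h. A *v h = b"
  shows "invertible A"
  using assms unfolding invertible_right_inverse matrix_right_invertible_surjective surj_def by metis

lemma loewner_le_matD:
  assumes "mat c \<preceq>\<^sub>L G"
  shows "c * (w \<bullet> w) \<le> w \<bullet> (G *v w)"
proof -
  have "mat c *v w = c *\<^sub>R w"
    by (simp add: vec_eq_iff matrix_vector_mult_def mat_def if_distrib[of "\<lambda>x. x * c" for c] sum.delta' cong: if_cong)
  moreover have "0 \<le> w \<bullet> ((G - mat c) *v w)"
    using assms by (simp add: loewner_le_def)
  ultimately show ?thesis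
    by (simp add: matrix_vector_mult_diff_rdistrib inner_diff_right)
qed

section \<open>The Cramer--Rao bound\<close>

lemma target_eq_sum: "target \<theta> = (\<Sum>a\<in>UNIV. \<theta> $ Inl a * \<theta> $ Inr a)"
  by (simp add: target_def x_part_def y_part_def inner_vec_def)

lemma target_join_param [simp]: "target (join_param x y) = x \<bullet> y"
  by (simp add: target_def)

lemma gradient_target: "gradient target (join_param x y) = join_param y x"
proof (rule gradient_eqI)
  have "((\<lambda>\<theta>. \<Sum>a\<in>UNIV. \<theta> $ Inl a * \<theta> $ Inr a) has_derivative
      (\<lambda>h. \<Sum>a\<in>UNIV. x $ a * h $ Inr a + h $ Inl a * y $ a)) (at (join_param x y))"
    by (rule derivative_eq_intros bounded_linear_imp_has_derivative bounded_linear_vec_nth refl)+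
      (simp add: join_param_def)
  moreover have "(\<Sum>a\<in>UNIV. x $ a * h $ Inr a + h $ Inl a * y $ a) = h \<bullet> join_param y x" for h
    by (simp add: inner_vec_def sum_UNIV_Plus join_param_def sum.distrib mult_ac)
  ultimately show "GDERIV target (join_param x y) :> join_param y x"
    by (simp add: gderiv_def target_eq_sum[abs_def])
qed

text \<open>The blocks of the information matrix are \<open>\<Sigma>\<^sup>1\<^sup>/\<^sup>2 G \<Sigma>\<^sup>1\<^sup>/\<^sup>2 / \<tau>\<^sup>2\<close>, where \<open>G\<close> is the Gram matrix of the
  upper rows of the orthonormal factor and \<open>\<Sigma>\<^sup>1\<^sup>/\<^sup>2\<close> is \<open>sqrt_diag \<sigma>\<close>. The outer scalings cancel,
  so solving against \<open>G\<close> solves the whole system; this is why the singular values disappear from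
  the Cramer--Rao bound. The \<open>x\<close>-half of the parameter is measured through \<open>V\<close> and the
  \<open>y\<close>-half through \<open>U\<close>.\<close>

lemma fisher_information_solve:
  fixes U :: "real^'r^('n1::finite + 'n2::finite)" and V :: "real^'r^('t1::finite + 't2::finite)"
  assumes "0 < \<tau>" and pos: "\<And>a. 0 < \<sigma> $ a"
    and w: "(transpose (upper_rows V) ** upper_rows V) *v w = b"
    and w': "(transpose (upper_rows U) ** upper_rows U) *v w' = b'"
  shows "fisher_information (\<Pi>\<^sub>M j\<in>UNIV. lborel) (likelihood \<tau> (scaled_factor U \<sigma>) (scaled_factor V \<sigma>)) \<theta> *v
      join_param (\<tau>\<^sup>2 *\<^sub>R (inv_sqrt_diag \<sigma> *v w)) (\<tau>\<^sup>2 *\<^sub>R (inv_sqrt_diag \<sigma> *v w')) =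
    join_param (sqrt_diag \<sigma> *v b) (sqrt_diag \<sigma> *v b')" (is "?F *v ?h = ?g")
proof (rule vector_eq_ldot[THEN iffD1, rule_format])
  fix v
  have row: "scaled_factor A \<sigma> $ k \<bullet> (inv_sqrt_diag \<sigma> *v u) = A $ k \<bullet> u" for A :: "real^'r^'k" and k u
    by (simp add: scaled_factor_row inner_diag_mat[symmetric] sqrt_diag_inverse pos)
  have row': "scaled_factor A \<sigma> $ k \<bullet> u = A $ k \<bullet> (sqrt_diag \<sigma> *v u)" for A :: "real^'r^'k" and k u
    by (simp add: scaled_factor_row inner_diag_mat)
  have "v \<bullet> (?F *v ?h) =
      (\<Sum>s\<in>UNIV. (V $ Inl s \<bullet> (sqrt_diag \<sigma> *v x_part v)) * (V $ Inl s \<bullet> w)) +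
      (\<Sum>k\<in>UNIV. (U $ Inl k \<bullet> (sqrt_diag \<sigma> *v y_part v)) * (U $ Inl k \<bullet> w'))"
    using assms(1)
    by (simp add: inner_fisher_information sum_UNIV_Plus signal_def inner_commute[of _ "scaled_factor V \<sigma> $ _"]
        row row'[of _ _ "x_part v"] row'[of _ _ "y_part v"] add_divide_distrib sum_divide_distrib mult.left_commute)
  also have "\<dots> = (sqrt_diag \<sigma> *v x_part v) \<bullet> b + (sqrt_diag \<sigma> *v y_part v) \<bullet> b'"
    by (simp add: inner_gram_upper_rows[symmetric] w w')
  also have "\<dots> = join_param (x_part v) (y_part v) \<bullet> ?g"
    by (simp only: inner_join_param inner_diag_mat)
  finally show "v \<bullet> (?F *v ?h) = v \<bullet> ?g" by simp
qed

lemma invertible_fisher_information: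
  fixes U :: "real^'r^('n1::finite + 'n2::finite)" and V :: "real^'r^('t1::finite + 't2::finite)"
  assumes "0 < \<tau>" and pos: "\<And>a. 0 < \<sigma> $ a"
    and "invertible (transpose (upper_rows U) ** upper_rows U)"
    and "invertible (transpose (upper_rows V) ** upper_rows V)"
  shows "invertible (fisher_information (\<Pi>\<^sub>M j\<in>UNIV. lborel)
    (likelihood \<tau> (scaled_factor U \<sigma>) (scaled_factor V \<sigma>)) \<theta>)"
proof (rule invertible_if_solvable)
  fix g :: "real^('r + 'r)"
  show "\<exists>h. fisher_information (\<Pi>\<^sub>M j\<in>UNIV. lborel)
      (likelihood \<tau> (scaled_factor U \<sigma>) (scaled_factor V \<sigma>)) \<theta> *v h = g"
    using fisher_information_solve[OF assms(1,2) matrix_inv_mult_vec(1)[OF assms(4), of "inv_sqrt_diag \<sigma> *v x_part g"]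
        matrix_inv_mult_vec(1)[OF assms(3), of "inv_sqrt_diag \<sigma> *v y_part g"], of \<theta>]
    by (auto simp: sqrt_diag_inverse pos)
qed

section \<open>The least favourable direction stays in the local ball\<close>

lemma inv_sqrt_diag_norm_le:
  fixes \<sigma> :: "real^('r::{finite,linorder})"
  assumes "\<And>a. 0 < \<sigma> $ a" and "\<And>a b. a \<le> b \<Longrightarrow> \<sigma> $ b \<le> \<sigma> $ a"
  shows "(inv_sqrt_diag \<sigma> *v w) \<bullet> (inv_sqrt_diag \<sigma> *v w) \<le> (w \<bullet> w) / smallest_sv \<sigma>"
  unfolding inner_vec_def sum_divide_distrib
proof (rule sum_mono)
  fix a
  have "0 < smallest_sv \<sigma>" "smallest_sv \<sigma> \<le> \<sigma> $ a"
    using assms by (simp_all add: smallest_sv_def)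
  then have "(w $ a)\<^sup>2 / \<sigma> $ a \<le> (w $ a)\<^sup>2 / smallest_sv \<sigma>"
    by (intro divide_left_mono) auto
  then show "(inv_sqrt_diag \<sigma> *v w) $ a \<bullet> (inv_sqrt_diag \<sigma> *v w) $ a \<le> w $ a \<bullet> w $ a / smallest_sv \<sigma>"
    using assms(1)[of a] by (simp add: diag_mat_mult_vec power2_eq_square)
qed

text \<open>In the application \<open>w\<close> solves a Gram system, and \<open>\<tau>\<^sup>2 (w \<bullet> G w)\<close> is one of the two summands of the Cramer--Rao
  bound. Bounding \<open>|w|\<^sup>2\<close> by the quadratic form, rather than by the right-hand side of the system,
  keeps a single factor \<open>1 / c\<close>.\<close>

lemma least_favourable_norm_le:
  fixes \<sigma> :: "real^('r::{finite,linorder})"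
  assumes "\<And>a. 0 < \<sigma> $ a" and "\<And>a b. a \<le> b \<Longrightarrow> \<sigma> $ b \<le> \<sigma> $ a"
    and "0 < c" "mat c \<preceq>\<^sub>L G" and g: "\<tau>\<^sup>2 * (w \<bullet> (G *v w)) \<le> g"
  shows "(\<tau>\<^sup>2 *\<^sub>R (inv_sqrt_diag \<sigma> *v w)) \<bullet> (\<tau>\<^sup>2 *\<^sub>R (inv_sqrt_diag \<sigma> *v w))
    \<le> \<tau>\<^sup>2 * g / (c * smallest_sv \<sigma>)"
proof -
  let ?u = "inv_sqrt_diag \<sigma> *v w"
  have sv: "0 < smallest_sv \<sigma>" using assms(1) by (simp add: smallest_sv_def)
  have "c * smallest_sv \<sigma> * (?u \<bullet> ?u) \<le> c * (w \<bullet> w)"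
    using inv_sqrt_diag_norm_le[OF assms(1,2), where w = w] sv \<open>0 < c\<close>
    by (simp add: field_simps)
  also have "\<dots> \<le> w \<bullet> (G *v w)"
    by (rule loewner_le_matD) fact
  finally have "\<tau>\<^sup>2 * (c * smallest_sv \<sigma> * (?u \<bullet> ?u)) \<le> \<tau>\<^sup>2 * (w \<bullet> (G *v w))"
    by (intro mult_left_mono) auto
  also note g
  finally have "\<tau>\<^sup>2 * (\<tau>\<^sup>2 * (c * smallest_sv \<sigma> * (?u \<bullet> ?u))) \<le> \<tau>\<^sup>2 * g"
    by (intro mult_left_mono) auto
  then show ?thesis
    using sv \<open>0 < c\<close> by (simp add: pos_le_divide_eq mult_ac)
qed

text \<open>With \<open>\<delta>\<^sup>2\<close> equal to the first factor on the left, the loss \<open>\<pi>\<^sup>2 / \<delta>\<^sup>2\<close> is exactly the relative loss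
  in the risk bound times \<open>\<gamma>\<close>. The left-hand side works out to \<open>(c\<^sub>l / c\<^sub>u) (min N\<^sub>1 T\<^sub>1 / T\<^sub>1) (sv / N)\<close>,
  where the first two factors are at most one. The other half of the direction is covered by exchanging
  \<open>(N, N\<^sub>1)\<close> with \<open>(T, T\<^sub>1)\<close>, which is why the ball has the smaller of \<open>N\<close> and \<open>T\<close> in its radius and
  \<open>\<rho>\<close> the smaller of \<open>N\<^sub>1\<close> and \<open>T\<^sub>1\<close>.\<close>

lemma radius_arith:
  fixes N T N\<^sub>1 T\<^sub>1 c\<^sub>l c\<^sub>u sv \<omega> \<gamma> :: real
  assumes pos: "0 < N" "0 < T" "0 < N\<^sub>1" "0 < T\<^sub>1" "0 < c\<^sub>l" "c\<^sub>l \<le> c\<^sub>u" "0 < sv" "0 < \<omega>" "0 < \<gamma>"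
    and \<rho>: "\<rho> = \<omega> / sv * (1 / sqrt (min N\<^sub>1 T\<^sub>1))"
  shows "c\<^sub>l\<^sup>2 / (c\<^sub>u * \<rho>\<^sup>2 * \<gamma>) * ((\<omega> / sqrt (N * T))\<^sup>2 * \<gamma> / (c\<^sub>l * T\<^sub>1 / T * sv))
    \<le> (sqrt sv / sqrt (min N T))\<^sup>2"
proof -
  let ?m = "min N\<^sub>1 T\<^sub>1"
  have m: "0 < ?m" "?m \<le> T\<^sub>1" using pos by auto
  have \<rho>2: "\<rho>\<^sup>2 = \<omega>\<^sup>2 / (sv\<^sup>2 * ?m)"
    using m by (simp add: \<rho> power_divide power_mult_distrib)
  have \<tau>2: "(\<omega> / sqrt (N * T))\<^sup>2 = \<omega>\<^sup>2 / (N * T)"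
    using pos by (simp add: power_divide)
  have "c\<^sub>l\<^sup>2 / (c\<^sub>u * \<rho>\<^sup>2 * \<gamma>) * ((\<omega> / sqrt (N * T))\<^sup>2 * \<gamma> / (c\<^sub>l * T\<^sub>1 / T * sv)) =
      (c\<^sub>l / c\<^sub>u) * (?m / T\<^sub>1) * (sv / N)"
    unfolding \<rho>2 \<tau>2 using pos m(1)
    by (simp add: field_simps power2_eq_square)
  also have "\<dots> \<le> 1 * 1 * (sv / min N T)"
    using pos m by (intro mult_mono divide_left_mono) auto
  also have "\<dots> = (sqrt sv / sqrt (min N T))\<^sup>2"
    using pos by (simp add: power_divide)
  finally show ?thesis .
qed

lemma line_in_linf_cball:
  fixes u :: "real^'r"
  assumes "\<delta>\<^sup>2 * (u \<bullet> u) \<le> \<epsilon>\<^sup>2" "0 \<le> \<epsilon>" "\<bar>s\<bar> \<le> \<delta>"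
  shows "z + s *\<^sub>R u \<in> linf_cball z \<epsilon>"
proof -
  have "\<bar>s * u $ a\<bar> \<le> \<epsilon>" for a
  proof (rule power2_le_imp_le)
    have "(u $ a)\<^sup>2 \<le> u \<bullet> u"
      using component_le_norm_cart[of u a] by (simp add: dot_square_norm abs_le_square_iff[symmetric])
    moreover have "s\<^sup>2 \<le> \<delta>\<^sup>2"
      using assms(3) by (simp add: abs_le_square_iff[symmetric])
    ultimately have "s\<^sup>2 * (u $ a)\<^sup>2 \<le> \<delta>\<^sup>2 * (u \<bullet> u)"
      by (intro mult_mono) auto
    then show "\<bar>s * u $ a\<bar>\<^sup>2 \<le> \<epsilon>\<^sup>2"
      using assms(1) by (simp add: power_mult_distrib)
  qed fact
  then show ?thesis by (simp add: linf_cball_def)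
qed

section \<open>The local minimax bound\<close>

text \<open>The supremum over the two balls dominates the risk at every point of the segment
  \<open>(x, y) + s (u, v)\<close>. Along it the bilinear target is quadratic in \<open>s\<close>, and its linear coefficient is
  the pairing of \<open>(u, v)\<close> with the gradient \<open>(y, x)\<close>.\<close>

lemma local_minimax_risk_line:
  fixes X :: "real^'r^('n1::finite + 'n2::finite)" and Y :: "real^'r^('t1::finite + 't2::finite)"
  assumes "0 < \<tau>" "0 < \<delta>" "0 \<le> \<epsilon>"
    and "\<delta>\<^sup>2 * (u \<bullet> u) \<le> \<epsilon>\<^sup>2" "\<delta>\<^sup>2 * (v \<bullet> v) \<le> \<epsilon>\<^sup>2"
  shows "ennreal (2 * (x \<bullet> v + u \<bullet> y) - (\<Sum>j\<in>UNIV. (signal X Y (join_param u v) j)\<^sup>2) / \<tau>\<^sup>2 - pi\<^sup>2 / \<delta>\<^sup>2)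
    \<le> local_minimax_risk \<tau> X Y x y \<epsilon>"
  unfolding local_minimax_risk_def
proof (rule INF_greatest)
  fix est :: "('t1 + 'n1 \<Rightarrow> real) \<Rightarrow> real"
  assume est: "est \<in> borel_measurable (\<Pi>\<^sub>M j\<in>UNIV. borel)"
  let ?risk = "\<lambda>(x', y'). \<integral>\<^sup>+z. ennreal ((est z - x' \<bullet> y')\<^sup>2) \<partial>observation_law \<tau> X Y (join_param x' y')"
  show "ennreal (2 * (x \<bullet> v + u \<bullet> y) - (\<Sum>j\<in>UNIV. (signal X Y (join_param u v) j)\<^sup>2) / \<tau>\<^sup>2 - pi\<^sup>2 / \<delta>\<^sup>2)
      \<le> (SUP p \<in> linf_cball x \<epsilon> \<times> linf_cball y \<epsilon>. ?risk p)"
  proof (rule van_trees_line[OF assms(1,2) est])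
    fix s assume "\<bar>s\<bar> \<le> \<delta>"
    then have "(x + s *\<^sub>R u, y + s *\<^sub>R v) \<in> linf_cball x \<epsilon> \<times> linf_cball y \<epsilon>"
      using assms by (auto intro: line_in_linf_cball)
    then have "?risk (x + s *\<^sub>R u, y + s *\<^sub>R v) \<le> (SUP p \<in> linf_cball x \<epsilon> \<times> linf_cball y \<epsilon>. ?risk p)"
      by (rule SUP_upper)
    moreover have "(x + s *\<^sub>R u) \<bullet> (y + s *\<^sub>R v) = x \<bullet> y + (x \<bullet> v + u \<bullet> y) * s + (u \<bullet> v) * s\<^sup>2"
      by (simp add: inner_add_left inner_add_right algebra_simps power2_eq_square)
    ultimately show "(\<integral>\<^sup>+z. ennreal ((est z - (x \<bullet> y + (x \<bullet> v + u \<bullet> y) * s + (u \<bullet> v) * s\<^sup>2))\<^sup>2)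
        \<partial>observation_law \<tau> X Y (join_param x y + s *\<^sub>R join_param u v)) \<le> (SUP p \<in> linf_cball x \<epsilon> \<times> linf_cball y \<epsilon>. ?risk p)"
      by (simp add: join_param_add_scaleR)
  qed
qed

theorem theorem2:
  fixes M :: "real^('t1::finite + 't2::finite)^('n1::finite + 'n2::finite)"
    and U :: "real^('r::{finite,linorder})^('n1 + 'n2)"
    and V :: "real^('r::_)^('t1 + 't2)"
    and \<sigma> :: "real^('r::_)"
    and \<omega> N T N\<^sub>1 T\<^sub>1 \<tau> :: real
    and X :: "real^('r::_)^('n1 + 'n2)"
    and Y :: "real^('r::_)^('t1 + 't2)"
    and i :: "'n1 + 'n2" and t :: "'t1 + 't2"
  assumes "N = real CARD('n1 + 'n2)" and "T = real CARD('t1 + 't2)"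
    and "N\<^sub>1 = real CARD('n1)" and "T\<^sub>1 = real CARD('t1)"
    and "rank M = CARD('r)"
    and "compact_svd M U \<sigma> V"
    and "X = scaled_factor U \<sigma>" and "Y = scaled_factor V \<sigma>"
    and "i \<in> range Inr" and "t \<in> range Inr"
    and "0 < \<omega>" and "\<tau> = \<omega> / sqrt (N * T)"
    and "invertible (transpose (upper_rows U) ** upper_rows U)"
    and "invertible (transpose (upper_rows V) ** upper_rows V)"
  shows "M $ i $ t = target (join_param (X $ i) (Y $ t))
    \<and> invertible (fisher_information (\<Pi>\<^sub>M j\<in>UNIV. lborel) (likelihood \<tau> X Y)
          (join_param (X $ i) (Y $ t)))
    \<and> cramer_rao_bound (\<Pi>\<^sub>M j\<in>UNIV. lborel) (likelihood \<tau> X Y) target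
          (join_param (X $ i) (Y $ t)) = gamma_star \<omega> U V i t
    \<and> (\<forall>c\<^sub>l c\<^sub>u \<epsilon> \<rho>.
         0 < c\<^sub>l \<longrightarrow> c\<^sub>l \<le> c\<^sub>u \<longrightarrow>
         mat (c\<^sub>l * N\<^sub>1 / N) \<preceq>\<^sub>L transpose (upper_rows U) ** upper_rows U \<longrightarrow>
         transpose (upper_rows U) ** upper_rows U \<preceq>\<^sub>L mat (c\<^sub>u * N\<^sub>1 / N) \<longrightarrow>
         mat (c\<^sub>l * T\<^sub>1 / T) \<preceq>\<^sub>L transpose (upper_rows V) ** upper_rows V \<longrightarrow>
         transpose (upper_rows V) ** upper_rows V \<preceq>\<^sub>L mat (c\<^sub>u * T\<^sub>1 / T) \<longrightarrow>
         \<epsilon> = sqrt (smallest_sv \<sigma>) / sqrt (min N T) \<longrightarrow>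
         \<rho> = \<omega> / smallest_sv \<sigma> * (1 / sqrt (min N\<^sub>1 T\<^sub>1)) \<longrightarrow>
         local_minimax_risk \<tau> X Y (X $ i) (Y $ t) \<epsilon>
           \<ge> ennreal ((1 - c\<^sub>u * pi\<^sup>2 / c\<^sub>l\<^sup>2 * \<rho>\<^sup>2) * gamma_star \<omega> U V i t))"
proof -
  let ?GU = "transpose (upper_rows U) ** upper_rows U"
  let ?GV = "transpose (upper_rows V) ** upper_rows V"
  let ?\<theta> = "join_param (X $ i) (Y $ t)"
  let ?F = "fisher_information (\<Pi>\<^sub>M j\<in>UNIV. lborel) (likelihood \<tau> X Y) ?\<theta>"
  define \<gamma> where "\<gamma> = gamma_star \<omega> U V i t"
  define w where "w = matrix_inv ?GV *v (V $ t)"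
  define w' where "w' = matrix_inv ?GU *v (U $ i)"
  \<comment> \<open>\<open>(u, v)\<close> is the inverse information matrix applied to the gradient \<open>(y, x)\<close> of the target.\<close>
  define u where "u = \<tau>\<^sup>2 *\<^sub>R (inv_sqrt_diag \<sigma> *v w)"
  define v where "v = \<tau>\<^sup>2 *\<^sub>R (inv_sqrt_diag \<sigma> *v w')"
  have M: "M = U ** diag_mat \<sigma> ** transpose V"
    and pos: "\<And>a. 0 < \<sigma> $ a" and mono: "\<And>a b. a \<le> b \<Longrightarrow> \<sigma> $ b \<le> \<sigma> $ a"
    using assms(6) by (auto simp: compact_svd_def)
  have X: "X $ k = sqrt_diag \<sigma> *v (U $ k)" and Y: "Y $ l = sqrt_diag \<sigma> *v (V $ l)" for k l
    by (simp_all add: assms(7,8) scaled_factor_row)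
  have N: "0 < N" "0 < T" "0 < N\<^sub>1" "0 < T\<^sub>1"
    using assms(1-4) by (auto intro: add_pos_pos)
  have \<tau>: "0 < \<tau>" "\<tau>\<^sup>2 = \<omega>\<^sup>2 / (N * T)"
    using N assms(11,12) by (simp_all add: power_divide)
  have w: "?GV *v w = V $ t" and w': "?GU *v w' = U $ i"
    unfolding w_def w'_def by (rule matrix_inv_mult_vec assms)+

  have entry: "M $ i $ t = target ?\<theta>"
  proof -
    have "M $ i $ t = (\<Sum>a\<in>UNIV. U $ i $ a * \<sigma> $ a * V $ t $ a)"
      by (simp add: M matrix_matrix_mult_def transpose_def)
         (simp add: diag_mat_def if_distrib[of "\<lambda>x. c * x" for c] sum.delta cong: if_cong)
    also have "\<dots> = X $ i \<bullet> Y $ t"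
    proof -
      have "U $ i $ a * \<sigma> $ a * V $ t $ a = X $ i $ a * Y $ t $ a" for a
      proof -
        have "X $ i $ a * Y $ t $ a = U $ i $ a * (sqrt (\<sigma> $ a) * sqrt (\<sigma> $ a)) * V $ t $ a"
          unfolding X Y diag_mat_mult_vec vec_lambda_beta by (simp only: mult_ac)
        then show ?thesis using pos[of a] by simp
      qed
      then show ?thesis by (simp add: inner_vec_def)
    qed
    finally show ?thesis by simp
  qed
  have invF: "invertible ?F"
    unfolding assms(7,8) by (rule invertible_fisher_information[OF \<tau>(1) pos assms(13,14)])
  have F: "?F *v join_param u v = join_param (Y $ t) (X $ i)"
    unfolding u_def v_def X Y unfolding assms(7,8)
    by (rule fisher_information_solve[OF \<tau>(1) pos w w'])
  have unscale: "(sqrt_diag \<sigma> *v b) \<bullet> (\<tau>\<^sup>2 *\<^sub>R (inv_sqrt_diag \<sigma> *v c)) = \<tau>\<^sup>2 * (c \<bullet> b)" for b c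
    by (simp add: inner_diag_mat[symmetric] sqrt_diag_inverse pos inner_commute[of b])
  have uy: "u \<bullet> Y $ t = \<tau>\<^sup>2 * (w \<bullet> V $ t)" and xv: "X $ i \<bullet> v = \<tau>\<^sup>2 * (w' \<bullet> U $ i)"
    unfolding u_def v_def X Y by (simp_all only: unscale inner_commute[of _ "sqrt_diag \<sigma> *v (V $ t)"])
  have \<gamma>: "\<gamma> = u \<bullet> Y $ t + X $ i \<bullet> v"
  proof -
    have "\<gamma> = \<tau>\<^sup>2 * (U $ i \<bullet> w' + V $ t \<bullet> w)"
      by (simp only: \<gamma>_def gamma_star_def \<tau>(2) assms(1,2) w_def w'_def)
    then show ?thesis
      by (simp add: uy xv inner_commute[of w] inner_commute[of w'] distrib_left)
  qed
  have info: "(\<Sum>j\<in>UNIV. (signal X Y (join_param u v) j)\<^sup>2) / \<tau>\<^sup>2 = \<gamma>"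
    using inner_fisher_information[OF \<tau>(1), of "join_param u v" X Y ?\<theta> "join_param u v"]
    by (simp add: F inner_join_param \<gamma> power2_eq_square inner_commute)
  have crb: "cramer_rao_bound (\<Pi>\<^sub>M j\<in>UNIV. lborel) (likelihood \<tau> X Y) target ?\<theta> = \<gamma>"
  proof -
    have "matrix_inv ?F *v join_param (Y $ t) (X $ i) = join_param u v"
      using matrix_inv_mult_vec(2)[OF invF] F by metis
    then show ?thesis
      by (simp add: cramer_rao_bound_def gradient_target inner_join_param \<gamma> inner_commute)
  qed

  have minimax: "ennreal ((1 - c\<^sub>u * pi\<^sup>2 / c\<^sub>l\<^sup>2 * \<rho>\<^sup>2) * \<gamma>) \<le> local_minimax_risk \<tau> X Y (X $ i) (Y $ t) \<epsilon>"
    if c: "0 < c\<^sub>l" "c\<^sub>l \<le> c\<^sub>u"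
      and GU: "mat (c\<^sub>l * N\<^sub>1 / N) \<preceq>\<^sub>L ?GU" and GV: "mat (c\<^sub>l * T\<^sub>1 / T) \<preceq>\<^sub>L ?GV"
      and \<epsilon>: "\<epsilon> = sqrt (smallest_sv \<sigma>) / sqrt (min N T)"
      and \<rho>: "\<rho> = \<omega> / smallest_sv \<sigma> * (1 / sqrt (min N\<^sub>1 T\<^sub>1))"
    for c\<^sub>l c\<^sub>u \<epsilon> \<rho>
  proof (cases "0 < \<gamma>")
    case False
    moreover have "0 \<le> \<gamma>" unfolding info[symmetric] by (simp add: sum_nonneg)
    ultimately show ?thesis by simp
  next
    case True
    have sv: "0 < smallest_sv \<sigma>" using pos by (simp add: smallest_sv_def)
    have "0 < \<rho>" using sv N assms(11) by (simp add: \<rho>)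
    \<comment> \<open>The length for which \<open>\<pi>\<^sup>2 / \<delta>\<^sup>2\<close> equals the loss \<open>c\<^sub>u \<pi>\<^sup>2 / c\<^sub>l\<^sup>2 * \<rho>\<^sup>2 * \<gamma>\<close> granted by the claim.\<close>
    define \<delta> where "\<delta> = c\<^sub>l / (\<rho> * sqrt (c\<^sub>u * \<gamma>))"
    have "0 < \<delta>" using c \<open>0 < \<rho>\<close> True by (simp add: \<delta>_def)
    have \<delta>2: "\<delta>\<^sup>2 = c\<^sub>l\<^sup>2 / (c\<^sub>u * \<rho>\<^sup>2 * \<gamma>)"
      using c True by (simp add: \<delta>_def power_divide power_mult_distrib mult_ac)
    have "0 \<le> w \<bullet> (?GV *v w)" "0 \<le> w' \<bullet> (?GU *v w')"
      unfolding inner_gram_upper_rows by (auto intro: sum_nonneg)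
    then have part: "\<tau>\<^sup>2 * (w \<bullet> (?GV *v w)) \<le> \<gamma>" "\<tau>\<^sup>2 * (w' \<bullet> (?GU *v w')) \<le> \<gamma>"
      by (simp_all add: \<gamma> uy xv w w')
    have uu: "\<delta>\<^sup>2 * (u \<bullet> u) \<le> \<epsilon>\<^sup>2"
    proof -
      have "u \<bullet> u \<le> \<tau>\<^sup>2 * \<gamma> / (c\<^sub>l * T\<^sub>1 / T * smallest_sv \<sigma>)"
        unfolding u_def using c N by (intro least_favourable_norm_le[OF pos mono _ GV] part) auto
      then have "\<delta>\<^sup>2 * (u \<bullet> u) \<le> \<delta>\<^sup>2 * (\<tau>\<^sup>2 * \<gamma> / (c\<^sub>l * T\<^sub>1 / T * smallest_sv \<sigma>))"
        by (intro mult_left_mono) auto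
      also have "\<dots> \<le> \<epsilon>\<^sup>2"
        unfolding \<delta>2 \<epsilon> assms(12) by (intro radius_arith[OF _ _ N(3)] N c sv assms(11) True \<rho>)
      finally show ?thesis .
    qed
    have vv: "\<delta>\<^sup>2 * (v \<bullet> v) \<le> \<epsilon>\<^sup>2"
    proof -
      have "v \<bullet> v \<le> \<tau>\<^sup>2 * \<gamma> / (c\<^sub>l * N\<^sub>1 / N * smallest_sv \<sigma>)"
        unfolding v_def using c N by (intro least_favourable_norm_le[OF pos mono _ GU] part) auto
      then have "\<delta>\<^sup>2 * (v \<bullet> v) \<le> \<delta>\<^sup>2 * (\<tau>\<^sup>2 * \<gamma> / (c\<^sub>l * N\<^sub>1 / N * smallest_sv \<sigma>))"
        by (intro mult_left_mono) auto
      also have "\<dots> \<le> \<epsilon>\<^sup>2"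
        unfolding \<delta>2 \<epsilon> assms(12) mult.commute[of N T] min.commute[of N T]
        by (intro radius_arith[OF _ _ N(4)] N c sv assms(11) True) (simp add: \<rho> min.commute)
      finally show ?thesis .
    qed
    have "(1 - c\<^sub>u * pi\<^sup>2 / c\<^sub>l\<^sup>2 * \<rho>\<^sup>2) * \<gamma> = 2 * (X $ i \<bullet> v + u \<bullet> Y $ t) - \<gamma> - pi\<^sup>2 / \<delta>\<^sup>2"
      unfolding \<delta>2 using c by (simp add: \<gamma>[symmetric] add.commute field_simps)
    moreover have "0 \<le> \<epsilon>" using sv N by (simp add: \<epsilon>)
    ultimately show ?thesis
      using local_minimax_risk_line[OF \<tau>(1) \<open>0 < \<delta>\<close> _ uu vv, of "X $ i" "Y $ t" X Y]
      by (simp add: info)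
  qed
  show ?thesis
    using entry invF crb minimax unfolding \<gamma>_def by blast
qed

end
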